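(* Let $n\ge1$, let $\alpha_1,\dots,\alpha_n$ be infinite ordinals and $X=\alpha_1\times\dots\times\alpha_n$. (1) Write each $\alpha_i$ in developed Cantor normal form $\alpha_i=\sum_{j<l_i'}\omega^{\alpha'_{i,j}}\cdot a_{i,j}$ with $\alpha'_{i,0}>\dots>\alpha'_{i,l'_i-1}$ and positive integers $a_{i,j}$. Let $Gr'(X)$ be the set of $t\in\{0,\dots,l_1'-1\}\times\dots\times\{0,\dots,l_n'-1\}$ with $t(k)=0$ for some $k$, and $X_t=\omega^{\alpha'_{1,t(1)}}\times\dots\times\omega^{\alpha'_{n,t(n)}}$. Then $$\mathbf{w}(X)=\bigoplus_{t\in Gr'(X)}\mathbf{w}(X_t)\otimes\Bigl(\prod_{i:\,t(i)=0}a_{i,0}-\prod_{i:\,t(i)=0}(a_{i,0}-1)\Bigr)\cdot\prod_{i:\,t(i)>0}a_{i,t(i)}.$$ (2) Write each $\alpha_i$ in short normal form $\alpha_i=\omega^{\alpha_i'}\cdot a_i+\sigma_i$ with $a_i$ a positive integer and $\sigma_i<\omega^{\alpha_i'}$. For nonempty $I\subseteq[1,n]$ let $X_I$ be the cartesian product (in the order of indices) whose $i$-th factor is $\omega^{\alpha_i'}$ if $i\in I$ and $\sigma_i$ if $i\notin I$. Then $$\mathbf{w}(X)=\bigoplus_{\emptyset\ne I\subseteq[1,n]}\mathbf{w}(X_I)\otimes\Bigl(\prod_{i\in I}a_i-\prod_{i\in I}(a_i-1)\Bigr).$$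
   Context: Products of ordinals have the componentwise order. The width $\mathbf{w}(A)$ of a wqo $A$ is the rank of the forest of nonempty finite sequences of pairwise incomparable elements of $A$ ordered by initial segment (the empty wqo has width $0$). $\oplus$ and $\otimes$ are the natural (Hessenberg) sum and product of ordinals; the integer coefficients are computed in $\mathbb{N}$. *)

theory Defs
  imports Main
begin

text \<open>Ordinals are represented, as in Main's BNF well-order library, by well-order
relations (reflexive on their field, (x,y) in r meaning x \<le> y), compared up to
order-isomorphism with =o, \<le>o, <o (heterogeneous in the carrier type).\<close>

text \<open>omega^beta: finitely supported functions Field beta \<rightarrow> nat, ordered by
comparing at the largest point (w.r.t. beta) where they differ (Hausdorff).\<close>
definition omega_exp :: "'a rel \<Rightarrow> ('a \<Rightarrow> nat) rel" where
  "omega_exp \<beta> =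
    {(f, g). (\<forall>x. x \<notin> Field \<beta> \<longrightarrow> f x = 0) \<and> finite {x. f x \<noteq> 0}
           \<and> (\<forall>x. x \<notin> Field \<beta> \<longrightarrow> g x = 0) \<and> finite {x. g x \<noteq> 0}
           \<and> (f = g \<or> (\<exists>x\<in>Field \<beta>. f x < g x \<and>
                   (\<forall>y\<in>Field \<beta>. (x, y) \<in> \<beta> \<and> y \<noteq> x \<longrightarrow> f y = g y)))}"

definition ord_mult_nat :: "'a rel \<Rightarrow> nat \<Rightarrow> (nat \<times> 'a) rel" where
  "ord_mult_nat r c =
    {((k, x), (k', x')). k < c \<and> k' < c \<and> x \<in> Field r \<and> x' \<in> Field r \<and>
        (k < k' \<or> (k = k' \<and> (x, x') \<in> r))}"

definition ord_sum_fam :: "nat \<Rightarrow> (nat \<Rightarrow> 'a rel) \<Rightarrow> (nat \<times> 'a) rel" where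
  "ord_sum_fam L r =
    {((j, x), (j', x')). j < L \<and> j' < L \<and> x \<in> Field (r j) \<and> x' \<in> Field (r j') \<and>
        (j < j' \<or> (j = j' \<and> (x, x') \<in> r j))}"

definition ord_sum2 :: "'a rel \<Rightarrow> 'b rel \<Rightarrow> ('a + 'b) rel" where
  "ord_sum2 r s =
    {(Inl x, Inl y) | x y. (x, y) \<in> r} \<union> {(Inr x, Inr y) | x y. (x, y) \<in> s}
    \<union> {(Inl x, Inr y) | x y. x \<in> Field r \<and> y \<in> Field s}"

definition cnf_ord :: "nat \<Rightarrow> (nat \<Rightarrow> 'a rel) \<Rightarrow> (nat \<Rightarrow> nat) \<Rightarrow> (nat \<times> nat \<times> ('a \<Rightarrow> nat)) rel" where
  "cnf_ord L e c = ord_sum_fam L (\<lambda>j. ord_mult_nat (omega_exp (e j)) (c j))"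

definition is_dev_cnf :: "'b rel \<Rightarrow> nat \<Rightarrow> (nat \<Rightarrow> 'a rel) \<Rightarrow> (nat \<Rightarrow> nat) \<Rightarrow> bool" where
  "is_dev_cnf \<alpha> L e c \<longleftrightarrow>
     (\<forall>j<L. Well_order (e j) \<and> c j > 0) \<and>
     (\<forall>j. Suc j < L \<longrightarrow> (e (Suc j), e j) \<in> ordLess) \<and>
     (\<alpha>, cnf_ord L e c) \<in> ordIso"

text \<open>Natural (Hessenberg) combination  (+)_{t\<in>T} r t \<otimes> m t  with natural number
multipliers m t, defined through Cantor normal forms over a common decreasing list of
exponents (coefficients may be 0): gamma is this natural sum iff there are exponents
e_0 > ... > e_(L-1) and coefficients c t j with r t = sum_j omega^(e j) \<cdot> c t j and
gamma = sum_j omega^(e j) \<cdot> (sum_t m t * c t j).  (For a natural number m,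
(sum_j omega^(e j) c_j) \<otimes> m = sum_j omega^(e j) (c_j m).)\<close>
definition is_hessenberg_comb ::
    "'x rel \<Rightarrow> 't set \<Rightarrow> ('t \<Rightarrow> 'y rel) \<Rightarrow> ('t \<Rightarrow> nat) \<Rightarrow> bool" where
  "is_hessenberg_comb \<gamma> T r m \<longleftrightarrow> finite T \<and>
     (\<exists>L (e :: nat \<Rightarrow> 'x rel) c.
        (\<forall>j<L. Well_order (e j)) \<and> (\<forall>j. Suc j < L \<longrightarrow> (e (Suc j), e j) \<in> ordLess) \<and>
        (\<forall>t\<in>T. (r t, cnf_ord L e (c t)) \<in> ordIso) \<and>
        (\<gamma>, cnf_ord L e (\<lambda>j. \<Sum>t\<in>T. m t * c t j)) \<in> ordIso)"

definition antichain_seqs :: "'b set \<Rightarrow> ('b \<Rightarrow> 'b \<Rightarrow> bool) \<Rightarrow> 'b list set" where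
  "antichain_seqs A le =
    {xs. xs \<noteq> [] \<and> set xs \<subseteq> A \<and>
         (\<forall>i<length xs. \<forall>j<length xs. i \<noteq> j \<longrightarrow>
             \<not> le (xs ! i) (xs ! j) \<and> \<not> le (xs ! j) (xs ! i))}"

text \<open>Rank of a well-founded forest F (ordered by initial segment, children being
proper extensions): the least ordinal gamma admitting a map f : F \<rightarrow> gamma that is
strictly decreasing along proper extensions (equivalently sup of rank(node)+1).\<close>
definition forest_rank_map :: "'c list set \<Rightarrow> 'c list rel \<Rightarrow> ('c list \<Rightarrow> 'c list) \<Rightarrow> bool" where
  "forest_rank_map F \<gamma> f \<longleftrightarrow>
     (\<forall>xs\<in>F. f xs \<in> Field \<gamma> \<and>
        (\<forall>ys\<in>F. (\<exists>zs. zs \<noteq> [] \<and> ys = xs @ zs) \<longrightarrow> (f ys, f xs) \<in> \<gamma> \<and> f ys \<noteq> f xs))"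

definition is_forest_rank :: "'c list set \<Rightarrow> 'c list rel \<Rightarrow> bool" where
  "is_forest_rank F \<gamma> \<longleftrightarrow> Well_order \<gamma> \<and> (\<exists>f. forest_rank_map F \<gamma> f) \<and>
     (\<forall>\<gamma>'. Well_order \<gamma>' \<and> (\<exists>f. forest_rank_map F \<gamma>' f) \<longrightarrow> (\<gamma>, \<gamma>') \<in> ordLeq)"

definition width :: "'b set \<Rightarrow> ('b \<Rightarrow> 'b \<Rightarrow> bool) \<Rightarrow> 'b list rel" where
  "width A le = (SOME \<gamma>. is_forest_rank (antichain_seqs A le) \<gamma>)"

definition prod_set :: "'a rel list \<Rightarrow> 'a list set" where
  "prod_set rs = {xs. length xs = length rs \<and> (\<forall>i<length rs. xs ! i \<in> Field (rs ! i))}"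

definition prod_le :: "'a rel list \<Rightarrow> 'a list \<Rightarrow> 'a list \<Rightarrow> bool" where
  "prod_le rs xs ys \<longleftrightarrow> (\<forall>i<length rs. (xs ! i, ys ! i) \<in> rs ! i)"

definition width_prod :: "'a rel list \<Rightarrow> 'a list list rel" where
  "width_prod rs = width (prod_set rs) (prod_le rs)"

text \<open>Transport a relation along Inl / Inr (to form products with mixed factor types).\<close>
definition rel_Inl :: "'a rel \<Rightarrow> ('a + 'b) rel" where
  "rel_Inl r = map_prod Inl Inl ` r"
definition rel_Inr :: "'b rel \<Rightarrow> ('a + 'b) rel" where
  "rel_Inr r = map_prod Inr Inr ` r"

end

theory Submission
  imports Defs "HOL-Library.Multiset_Order" "HOL-Library.FuncSet"
begin

text \<open>
  Cut each factor \<open>\<alpha>\<^sub>i\<close> into its blocks \<open>\<omega>\<^bsup>e\<^esup>\<close>, in decreasing order of exponents, and the product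
  \<open>X\<close> into the resulting cells, indexed by positions \<open>p\<close>. The cells with some coordinate of \<open>p\<close>
  equal to \<open>0\<close> form the frontier, and \<open>w(X)\<close> is the natural sum of the widths of the frontier cells.

  Upper bound: every cell lies on the diagonal \<open>p, p + (1,\<dots>,1), \<dots>\<close> of exactly one frontier cell
  \<open>p\<close>. Different cells of a diagonal are pairwise comparable and embed into the first one, so a
  diagonal has the width of its frontier cell; and width is subadditive for the natural sum.

  Lower bound: the width of a cell is additively indecomposable, so the natural sum of the widths
  of the frontier cells is their ordinal sum in decreasing order. Playing antichains in the
  narrowest cells first, and in higher positions first among cells of equal width, a copy of each
  remaining cell always survives: its leading infinite coordinates can be shifted above every
  element already played.

  Grouping the frontier cells by the exponents of their sides gives (1). In (2) the same argument
  applies to each \<open>X\<^sub>I\<close>, all of whose cells are frontier cells, and the two sums are compared.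

  Ordinals are finite multisets over a well-ordered type of exponents: Cantor normal form is
  built in, the multiset order is the order of ordinals, and multiset union is the natural sum.
\<close>

section \<open>Multisets as ordinals\<close>

text \<open>Comparison of Cantor normal forms: the largest exponent with different coefficients
  decides. This is also the rule by which \<open>omega_exp\<close> orders functions.\<close>

lemma less_multiset_iff_max_diff:
  fixes M N :: "'o::linorder multiset"
  shows "M < N \<longleftrightarrow> (\<exists>x. count M x < count N x \<and> (\<forall>y>x. count M y = count N y))"
proof
  assume "M < N"
  let ?D = "{x. count M x \<noteq> count N x}"
  have "x \<in> set_mset M \<union> set_mset N" if "count M x \<noteq> count N x" for x
  proof (rule ccontr)
    assume "x \<notin> set_mset M \<union> set_mset N"
    then have "count M x = 0" "count N x = 0" by (simp_all add: not_in_iff)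
    then show False using that by simp
  qed
  then have "?D \<subseteq> set_mset M \<union> set_mset N" by blast
  then have fin: "finite ?D"
    by (rule finite_subset) simp
  have "M \<noteq> N"
    using \<open>M < N\<close> by simp
  then have ne: "?D \<noteq> {}"
    unfolding multiset_eq_iff by blast
  define x where "x = Max ?D"
  have x: "x \<in> ?D"
    unfolding x_def using Max_in[OF fin ne] .
  have above: "\<forall>y>x. count M y = count N y"
    using Max_ge[OF fin] unfolding x_def by (metis (mono_tags, lifting) leD mem_Collect_eq)
  \<comment> \<open>Otherwise the multiset order would ask for a larger exponent occurring more
    often in \<open>N\<close>, but \<open>x\<close> is the largest difference.\<close>
  have "\<not> count N x < count M x"
  proof
    assume "count N x < count M x"
    then obtain y where "x < y" "count M y < count N y"
      using \<open>M < N\<close> unfolding less_multiset\<^sub>H\<^sub>O by blast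
    then show False using above by auto
  qed
  then show "\<exists>x. count M x < count N x \<and> (\<forall>y>x. count M y = count N y)"
    using x above by (intro exI[of _ x]) auto
next
  assume "\<exists>x. count M x < count N x \<and> (\<forall>y>x. count M y = count N y)"
  then obtain x where x: "count M x < count N x" "\<forall>y>x. count M y = count N y"
    by blast
  have "\<exists>x. y < x \<and> count M x < count N x" if "count N y < count M y" for y
  proof -
    have "\<not> x < y" "x \<noteq> y" using x that by auto
    then show ?thesis using x(1) by (meson linorder_neqE)
  qed
  moreover have "M \<noteq> N" using x(1) by auto
  ultimately show "M < N"
    unfolding less_multiset\<^sub>H\<^sub>O by blast
qed

definition mset_ge :: "'o::linorder multiset \<Rightarrow> 'o multiset \<Rightarrow> bool" where
  "mset_ge M N \<longleftrightarrow> (\<forall>x\<in>#M. \<forall>y\<in>#N. y \<le> x)"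

text \<open>An exponent of \<open>N'\<close> lies either at or below the exponent \<open>x\<close>
  deciding \<open>N' < N\<close>, which occurs in \<open>N\<close>, or above it, and then it occurs
  in \<open>N\<close> itself.\<close>

lemma mset_ge_less:
  assumes "mset_ge M N" "N' < N"
  shows "mset_ge M N'"
proof -
  obtain x where x: "count N' x < count N x" "\<forall>y>x. count N' y = count N y"
    using assms(2) unfolding less_multiset_iff_max_diff by blast
  have "\<exists>z\<in>#N. y \<le> z" if "y \<in># N'" for y
  proof (cases "y \<le> x")
    case True
    then show ?thesis using x(1) by (metis count_inI less_zeroE)
  next
    case False
    then have "y \<in># N" using x(2) that by (metis count_eq_zero_iff not_le_imp_less)
    then show ?thesis by blast
  qed
  then show ?thesis
    using assms(1) unfolding mset_ge_def by (meson order_trans)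
qed

text \<open>Under \<^const>\<open>mset_ge\<close> the natural sum agrees with the ordinal sum.\<close>

lemma less_add_cases:
  fixes M N K :: "'o::linorder multiset"
  assumes "mset_ge M N" "K < M + N"
  obtains "K < M" | N' where "K = M + N'" "N' < N"
proof (cases "K < M")
  case False
  have "M \<subseteq># K"
  proof (cases "K = M")
    case False
    with \<open>\<not> K < M\<close> have "M < K" by auto
    then obtain x where x: "count M x < count K x" "\<forall>z>x. count M z = count K z"
      unfolding less_multiset_iff_max_diff by blast
    obtain y where y: "count K y < count M y + count N y"
        "\<forall>z>y. count K z = count M z + count N z"
      using assms(2) unfolding less_multiset_iff_max_diff by auto
    \<comment> \<open>\<open>x\<close> decides \<open>M < K\<close> and \<open>y\<close> decides
      \<open>K < M + N\<close>. Their maximum occurs in \<open>N\<close>, so all exponents of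
      \<open>M\<close> are at least \<open>v\<close>, hence at least \<open>x\<close>, where
      \<open>K\<close> has no fewer copies than \<open>M\<close>.\<close>
    define v where "v = max x y"
    have "v \<in># N"
    proof (cases "x < y")
      case True
      then have "count N y > 0" using x(2) y(1) by auto
      then show ?thesis using True by (simp add: v_def max.absorb2)
    next
      case False
      then have "count N x > 0"
      proof (cases "y = x")
        case True
        then show ?thesis using x(1) y(1) unfolding True by linarith
      next
        case neq: False
        then have "count K x = count M x + count N x" using False y(2) by simp
        then show ?thesis using x(1) by linarith
      qed
      then show ?thesis using False by (simp add: v_def max.absorb1 flip: count_greater_zero_iff)
    qed
    have "count M z \<le> count K z" for z
    proof (cases "z < v")
      case True
      then have "z \<notin># M" using assms(1) \<open>v \<in># N\<close> unfolding mset_ge_def by (meson not_le)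
      then show ?thesis by (simp add: not_in_iff)
    next
      case False
      then have "z \<ge> x" unfolding v_def by (metis max.boundedE not_le)
      then show ?thesis using x by (metis order.order_iff_strict)
    qed
    then show ?thesis by (simp add: mset_subset_eqI)
  qed simp
  then obtain N' where "K = M + N'" by (meson mset_subset_eq_exists_conv)
  then show ?thesis using that(2) assms(2) by auto
qed (rule that(1))

text \<open>\<open>{#x#}\<close> is omega^x, and a multiset lies below it when all its elements lie
  below \<open>x\<close>; so powers of omega are closed under natural sums.\<close>

lemma add_less_single:
  fixes M N :: "'o::linorder multiset"
  shows "M + N < {#x#} \<longleftrightarrow> M < {#x#} \<and> N < {#x#}"
  by (simp add: ball_Un)

section \<open>Bounds on the rank of the forest of antichain sequences\<close>

definition incomp :: "('b \<Rightarrow> 'b \<Rightarrow> bool) \<Rightarrow> 'b \<Rightarrow> 'b \<Rightarrow> bool" where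
  "incomp le x y \<longleftrightarrow> \<not> le x y \<and> \<not> le y x"

text \<open>The elements still playable once all of \<open>F\<close> has been played.\<close>

definition residual :: "('b \<Rightarrow> 'b \<Rightarrow> bool) \<Rightarrow> 'b set \<Rightarrow> 'b set \<Rightarrow> 'b set" where
  "residual le A F = {y\<in>A. \<forall>x\<in>F. incomp le x y}"

lemma residual_empty [simp]: "residual le A {} = A"
  by (auto simp: residual_def)

lemma residual_residual: "residual le (residual le A F) G = residual le A (F \<union> G)"
  by (auto simp: residual_def)

lemma residual_Un: "residual le (A \<union> B) F = residual le A F \<union> residual le B F"
  by (auto simp: residual_def)

text \<open>\<open>wle le A M\<close>: the antichain sequences of \<open>A\<close> have rank at most \<open>M\<close>, by recursion on
  the first element played.\<close>

inductive wle :: "('b \<Rightarrow> 'b \<Rightarrow> bool) \<Rightarrow> 'b set \<Rightarrow> 'o::wellorder \<Rightarrow> bool" for le where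
  wleI: "(\<And>x. x \<in> A \<Longrightarrow> \<exists>N<M. wle le (residual le A {x}) N) \<Longrightarrow> wle le A M"

lemma wle_iff: "wle le A M \<longleftrightarrow> (\<forall>x\<in>A. \<exists>N<M. wle le (residual le A {x}) N)"
  by (subst wle.simps) auto

lemma wleD: "wle le A M \<Longrightarrow> x \<in> A \<Longrightarrow> \<exists>N<M. wle le (residual le A {x}) N"
  by (rule bspec[OF iffD1[OF wle_iff]])

text \<open>\<open>h\<close> carries a play in \<open>B\<close>, move by move, to a play in
  \<open>A\<close>. Only incomparability must survive, so inclusions, shifts and order isomorphisms
  all qualify.\<close>

lemma wle_embed:
  assumes "wle le A M" "M \<le> M'" "h ` B \<subseteq> A"
    and "\<And>x y. x \<in> B \<Longrightarrow> y \<in> B \<Longrightarrow> incomp le' x y \<Longrightarrow> incomp le (h x) (h y)"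
  shows "wle le' B M'"
  using assms
proof (induction M arbitrary: A B M' rule: less_induct)
  case (less M)
  show ?case
  proof (rule wleI)
    fix x assume x: "x \<in> B"
    then obtain N where N: "N < M" "wle le (residual le A {h x}) N"
      using wleD[OF less.prems(1), of "h x"] less.prems(3) by blast
    have "wle le' (residual le' B {x}) N"
      by (rule less.IH[OF N order_refl])
        (use less.prems(3,4) x in \<open>auto simp: residual_def\<close>)
    then show "\<exists>N<M'. wle le' (residual le' B {x}) N"
      using N(1) less.prems(2) by (meson order.strict_trans2)
  qed
qed

lemma wle_mono: "wle le A M \<Longrightarrow> M \<le> M' \<Longrightarrow> B \<subseteq> A \<Longrightarrow> wle le B M'"
  by (rule wle_embed[where h = id]) simp_all

text \<open>A move in the union lowers the bound of the part it belongs to and does not raise the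
  other; the natural sum is strictly monotone in both arguments.\<close>

lemma wle_Un:
  fixes M N :: "'o::wellorder multiset"
  assumes "wle le A M" "wle le B N"
  shows "wle le (A \<union> B) (M + N)"
  using assms
proof (induction "M + N" arbitrary: A B M N rule: less_induct)
  case less
  show ?case
  proof (rule wleI)
    fix x assume "x \<in> A \<union> B"
    then show "\<exists>K<M + N. wle le (residual le (A \<union> B) {x}) K"
    proof
      assume "x \<in> A"
      then obtain M' where M': "M' < M" "wle le (residual le A {x}) M'"
        using wleD[OF less.prems(1)] by blast
      moreover have "wle le (residual le B {x}) N"
        using less.prems(2) by (rule wle_mono) (auto simp: residual_def)
      ultimately have "wle le (residual le (A \<union> B) {x}) (M' + N)"
        using less.hyps by (simp add: residual_Un)
      then show ?thesis using M'(1) by (meson add_strict_right_mono)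
    next
      assume "x \<in> B"
      then obtain N' where N': "N' < N" "wle le (residual le B {x}) N'"
        using wleD[OF less.prems(2)] by blast
      moreover have "wle le (residual le A {x}) M"
        using less.prems(1) by (rule wle_mono) (auto simp: residual_def)
      ultimately have "wle le (residual le (A \<union> B) {x}) (M + N')"
        using less.hyps by (simp add: residual_Un)
      then show ?thesis using N'(1) by (meson add_strict_left_mono)
    qed
  qed
qed

lemma wle_empty [simp]: "wle le {} M"
  by (rule wleI) simp

lemma wle_UN:
  fixes M :: "'i \<Rightarrow> 'o::wellorder multiset"
  assumes "finite S" "\<And>p. p \<in> S \<Longrightarrow> wle le (A p) (M p)"
  shows "wle le (\<Union>p\<in>S. A p) (\<Sum>p\<in>S. M p)"
  using assms
proof (induction S rule: finite_induct)
  case (insert p S)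
  then show ?case using wle_Un[of le "A p" "M p"] by simp
qed simp

text \<open>The first move fixes an index \<open>k\<close>: everything incomparable to it lies in
  \<open>A k\<close>.\<close>

lemma wle_comparable_UN:
  assumes "\<And>k. k \<in> S \<Longrightarrow> wle le (A k) M"
    and "\<And>k l x y. k \<in> S \<Longrightarrow> l \<in> S \<Longrightarrow> k \<noteq> l \<Longrightarrow> x \<in> A k \<Longrightarrow> y \<in> A l \<Longrightarrow> \<not> incomp le x y"
  shows "wle le (\<Union>k\<in>S. A k) M"
proof (rule wleI)
  fix x assume "x \<in> (\<Union>k\<in>S. A k)"
  then obtain k where k: "k \<in> S" "x \<in> A k" by blast
  then obtain N where N: "N < M" "wle le (residual le (A k) {x}) N"
    using wleD[OF assms(1)] by blast
  have "residual le (\<Union>k\<in>S. A k) {x} \<subseteq> residual le (A k) {x}"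
    using assms(2) k by (force simp: residual_def)
  then show "\<exists>N<M. wle le (residual le (\<Union>k\<in>S. A k) {x}) N"
    using N wle_mono by blast
qed

section \<open>Lower bounds for the rank, and the width as the least bound\<close>

definition wge :: "('b \<Rightarrow> 'b \<Rightarrow> bool) \<Rightarrow> 'b set \<Rightarrow> 'o::wellorder \<Rightarrow> bool" where
  "wge le A M \<longleftrightarrow> (\<forall>N. wle le A N \<longrightarrow> M \<le> N)"

text \<open>Dual recursion: every \<open>N < M\<close> must survive some first move. If
  \<open>N\<close> is no bound, some \<open>x\<close> defeats all values below \<open>N\<close>, and
  this failure is exactly the lower bound \<open>N\<close> for the residual of
  \<open>x\<close>.\<close>

lemma wge_iff: "wge le A M \<longleftrightarrow> (\<forall>N<M. \<exists>x\<in>A. wge le (residual le A {x}) N)"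
proof
  assume A: "wge le A M"
  show "\<forall>N<M. \<exists>x\<in>A. wge le (residual le A {x}) N"
  proof (intro allI impI)
    fix N assume "N < M"
    then have "\<not> wle le A N" using A unfolding wge_def by auto
    then obtain x where "x \<in> A" "\<forall>N'<N. \<not> wle le (residual le A {x}) N'"
      by (auto simp: wle_iff[of le A])
    then show "\<exists>x\<in>A. wge le (residual le A {x}) N"
      unfolding wge_def by (meson not_le)
  qed
next
  assume R: "\<forall>N<M. \<exists>x\<in>A. wge le (residual le A {x}) N"
  show "wge le A M"
    unfolding wge_def
  proof (intro allI impI, rule ccontr)
    fix N assume N: "wle le A N" "\<not> M \<le> N"
    then obtain x where x: "x \<in> A" "wge le (residual le A {x}) N"
      using R by (meson not_le)
    then obtain N' where "N' < N" "wle le (residual le A {x}) N'"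
      using wleD[OF N(1)] by blast
    then show False using x(2) unfolding wge_def by (meson not_le)
  qed
qed

lemma wgeD: "wge le A M \<Longrightarrow> N < M \<Longrightarrow> \<exists>x\<in>A. wge le (residual le A {x}) N"
  by (rule iffD1[OF wge_iff, rule_format])

lemma wge_embed:
  fixes M M' :: "'o::wellorder"
  assumes "wge le' B M'" "M \<le> M'" "h ` B \<subseteq> A"
    and "\<And>x y. x \<in> B \<Longrightarrow> y \<in> B \<Longrightarrow> incomp le' x y \<Longrightarrow> incomp le (h x) (h y)"
  shows "wge le A M"
  unfolding wge_def
proof (intro allI impI)
  fix N :: 'o assume "wle le A N"
  then have "wle le' B N" by (rule wle_embed) (use assms in auto)
  then have "M' \<le> N" using assms(1) unfolding wge_def by blast
  then show "M \<le> N" using assms(2) by simp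
qed

text \<open>Play the antichain in \<open>B\<close> first: a copy of \<open>A\<close> always survives, so the ranks add up as
  an ordinal sum.\<close>

lemma wge_Un:
  fixes M N :: "'o::wellorder multiset"
  assumes "wge le A M" "wge le B N" "mset_ge M N"
    and emb: "\<And>F. finite F \<Longrightarrow> F \<subseteq> B \<Longrightarrow> \<exists>h. h ` A \<subseteq> residual le A F \<and>
                 (\<forall>x\<in>A. \<forall>y\<in>A. incomp le x y \<longrightarrow> incomp le (h x) (h y))"
  shows "wge le (A \<union> B) (M + N)"
proof -
  \<comment> \<open>\<open>F\<close> holds the moves already made in \<open>B\<close>, and
    \<open>N'\<close> is the rank still guaranteed there. A value below \<open>M\<close> is met
    inside the surviving copy of \<open>A\<close>, a value \<open>M + N''\<close> by a further move
    in \<open>B\<close>.\<close>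
  have "wge le (residual le (A \<union> B) F) (M + N')"
    if "finite F" "F \<subseteq> B" "wge le (residual le B F) N'" "mset_ge M N'" for F N'
    using that
  proof (induction N' arbitrary: F rule: less_induct)
    case (less N')
    obtain h where h: "h ` A \<subseteq> residual le A F"
        "\<forall>x\<in>A. \<forall>y\<in>A. incomp le x y \<longrightarrow> incomp le (h x) (h y)"
      using emb less.prems by metis
    have base: "wge le (residual le (A \<union> B) F) M"
      using assms(1) by (rule wge_embed[where h = h]) (use h in \<open>auto simp: residual_Un\<close>)
    show ?case
      unfolding wge_iff[of le "residual le (A \<union> B) F"]
    proof (intro allI impI)
      fix K assume "K < M + N'"
      with less.prems(4) show "\<exists>x\<in>residual le (A \<union> B) F.
          wge le (residual le (residual le (A \<union> B) F) {x}) K"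
      proof (cases rule: less_add_cases)
        case 1
        then show ?thesis using wgeD[OF base] by blast
      next
        case (2 N'')
        then obtain x where x: "x \<in> residual le B F"
            "wge le (residual le (residual le B F) {x}) N''"
          using wgeD[OF less.prems(3)] by blast
        have "wge le (residual le (A \<union> B) (F \<union> {x})) (M + N'')"
        proof (rule less.IH[OF 2(2)])
          show "F \<union> {x} \<subseteq> B" using x(1) less.prems(2) by (auto simp: residual_def)
          show "mset_ge M N''" using mset_ge_less[OF less.prems(4) 2(2)] .
        qed (use x(2) less.prems(1) in \<open>auto simp: residual_residual\<close>)
        then show ?thesis
          unfolding 2(1) residual_residual using x(1) by (auto simp: residual_Un)
      qed
    qed
  qed
  from this[of "{}" N] show ?thesis using assms by simp
qed

text \<open>\<open>LEAST\<close> is meaningful only if some bound exists in the type; hence the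
  hypotheses \<open>wle le A K\<close> in what follows.\<close>

definition wd :: "('b \<Rightarrow> 'b \<Rightarrow> bool) \<Rightarrow> 'b set \<Rightarrow> 'o::wellorder" where
  "wd le A = (LEAST M. wle le A M)"

lemma wle_wd:
  fixes M :: "'o::wellorder"
  shows "wle le A M \<Longrightarrow> wle le A (wd le A :: 'o)"
  unfolding wd_def by (rule LeastI)

lemma wd_le: "wle le A M \<Longrightarrow> wd le A \<le> M"
  unfolding wd_def by (rule Least_le)

lemma wge_wd: "wge le A (wd le A)"
  unfolding wge_def by (simp add: wd_le)

lemma wd_eqI: "wle le A M \<Longrightarrow> wge le A M \<Longrightarrow> wd le A = M"
  unfolding wge_def by (intro order_antisym wd_le) (blast intro: wle_wd)+

section \<open>Boxes, cubes and blocks\<close>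

lemma mset_ge_add [simp]:
  "mset_ge (M + M') N \<longleftrightarrow> mset_ge M N \<and> mset_ge M' N"
  "mset_ge N (M + M') \<longleftrightarrow> mset_ge N M \<and> mset_ge N M'"
  "mset_ge {#} N" "mset_ge N {#}"
  unfolding mset_ge_def by (simp_all, blast+)

lemma mset_ge_sum:
  assumes "\<And>i. i \<in> I \<Longrightarrow> mset_ge (M i) N"
  shows "mset_ge (\<Sum>i\<in>I. M i) N"
  using assms by (induction I rule: infinite_finite_induct) simp_all

lemma mset_ge_sum_right:
  assumes "\<And>i. i \<in> I \<Longrightarrow> mset_ge N (M i)"
  shows "mset_ge N (\<Sum>i\<in>I. M i)"
  using assms by (induction I rule: infinite_finite_induct) simp_all

text \<open>Finds the block that contains \<open>K\<close> by peeling off the last block with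
  \<open>less_add_cases\<close>. This assigns to each coordinate of a point its position and its
  offset.\<close>

lemma less_sum_cases:
  fixes N :: "nat \<Rightarrow> 'o::linorder multiset"
  assumes "\<And>i j. i < j \<Longrightarrow> j < L \<Longrightarrow> mset_ge (N i) (N j)" "K < (\<Sum>j<L. N j)"
  shows "\<exists>j<L. \<exists>z<N j. K = (\<Sum>i<j. N i) + z"
  using assms
proof (induction L)
  case (Suc L)
  have "mset_ge (\<Sum>j<L. N j) (N L)"
    by (rule mset_ge_sum) (use Suc.prems(1) in auto)
  moreover have "K < (\<Sum>j<L. N j) + N L" using Suc.prems(2) by simp
  ultimately show ?case
  proof (cases rule: less_add_cases)
    case 1
    then have "\<exists>j<L. \<exists>z<N j. K = (\<Sum>i<j. N i) + z"
      by (intro Suc.IH) (use Suc.prems(1) in auto)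
    then show ?thesis using less_SucI by blast
  qed auto
qed simp

lemma sum_add_less:
  fixes N :: "nat \<Rightarrow> 'o::linorder multiset"
  assumes "i < j" "z < N i"
  shows "(\<Sum>k<i. N k) + z < (\<Sum>k<j. N k) + z'"
proof -
  have "(\<Sum>k<i. N k) + z < (\<Sum>k<i. N k) + N i"
    using assms(2) by simp
  also have "\<dots> = (\<Sum>k<Suc i. N k)" by simp
  also have "\<dots> \<le> (\<Sum>k<j. N k)"
    by (rule sum_mono2) (use assms(1) in auto)
  also have "\<dots> \<le> (\<Sum>k<j. N k) + z'" by simp
  finally show ?thesis .
qed

section \<open>Products of ordinals as boxes of functions\<close>

definition fle :: "nat \<Rightarrow> (nat \<Rightarrow> 'o::order) \<Rightarrow> (nat \<Rightarrow> 'o) \<Rightarrow> bool" where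
  "fle n f g \<longleftrightarrow> (\<forall>i<n. f i \<le> g i)"

text \<open>Coordinates from \<open>n\<close> on are unrestricted here and ignored by
  \<open>fle\<close>, so points that agree below \<open>n\<close> are never incomparable.\<close>

definition box :: "nat \<Rightarrow> (nat \<Rightarrow> 'o::order) \<Rightarrow> (nat \<Rightarrow> 'o) set" where
  "box n M = {f. \<forall>i<n. f i < M i}"

text \<open>As \<open>{#x i#}\<close> is omega^(x i), a cube is a product of powers of
  omega.\<close>

abbreviation cube :: "nat \<Rightarrow> (nat \<Rightarrow> 'o::linorder) \<Rightarrow> (nat \<Rightarrow> 'o multiset) set" where
  "cube n x \<equiv> box n (\<lambda>i. {#x i#})"

text \<open>The cell at position \<open>p\<close>: coordinate \<open>i\<close> runs through summand
  number \<open>p i\<close> of its factor, behind the earlier ones.\<close>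

definition block :: "nat \<Rightarrow> (nat \<Rightarrow> nat \<Rightarrow> 'o::linorder) \<Rightarrow> (nat \<Rightarrow> nat) \<Rightarrow> (nat \<Rightarrow> 'o multiset) set" where
  "block n y p = {f. \<forall>i<n. \<exists>z<{#y i (p i)#}. f i = (\<Sum>j<p i. {#y i j#}) + z}"

lemma incomp_fle:
  fixes f g :: "nat \<Rightarrow> 'o::linorder"
  shows "incomp (fle n) f g \<longleftrightarrow> (\<exists>i<n. f i < g i) \<and> (\<exists>i<n. g i < f i)"
  unfolding incomp_def fle_def by (meson not_le)

lemma box_mono: "(\<And>i. i < n \<Longrightarrow> M i \<le> M' i) \<Longrightarrow> box n M \<subseteq> box n M'"
  unfolding box_def by (auto intro: order.strict_trans2)

text \<open>Gives a shift that exceeds finitely many values at once; the nonzero \<open>z\<close>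
  makes it strict.\<close>

lemma less_add_sum_member:
  fixes z :: "'o::linorder multiset"
  assumes "finite F" "g \<in> F" "z \<noteq> {#}"
  shows "\<phi> g < z + (\<Sum>f\<in>F. \<phi> f)"
proof -
  have "\<phi> g \<le> (\<Sum>f\<in>F. \<phi> f)"
    unfolding sum.remove[OF assms(1,2)] by simp
  also have "\<dots> < z + (\<Sum>f\<in>F. \<phi> f)"
    using assms(3) by simp
  finally show ?thesis .
qed

lemma sum_less_single:
  assumes "\<And>f. f \<in> F \<Longrightarrow> \<phi> f < {#x :: 'o::linorder#}"
  shows "(\<Sum>f\<in>F. \<phi> f) < {#x#}"
  using assms
proof (induction F rule: infinite_finite_induct)
  case (insert f F)
  then have "\<phi> f < {#x#}" "sum \<phi> F < {#x#}" by blast+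
  then show ?case unfolding sum.insert[OF insert.hyps] add_less_single by (rule conjI)
qed simp_all

text \<open>The width of a cube is additively indecomposable: for a point \<open>c\<close>, the whole residual of \<open>c\<close>
  survives any finite antichain played above \<open>c\<close>, and what lies above \<open>c\<close> contains a copy of the
  cube.\<close>

lemma wd_cube_single:
  fixes x :: "nat \<Rightarrow> 'o::wellorder"
  assumes "wle (fle n) (cube n x) (K :: 'o multiset)"
  obtains \<gamma> :: 'o where "wd (fle n) (cube n x) = {#\<gamma>#}"
proof -
  let ?le = "fle n :: (nat \<Rightarrow> 'o multiset) \<Rightarrow> _"
  define W :: "'o multiset" where "W = wd ?le (cube n x)"
  have W: "wle ?le (cube n x) W" "wge ?le (cube n x) W"
    using wle_wd[OF assms] wge_wd unfolding W_def by auto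
  have "(\<lambda>i. {#}) \<in> cube n x" by (simp add: box_def)
  then have "W \<noteq> {#}" using wleD[OF W(1)] by auto
  define \<gamma> where "\<gamma> = Max_mset W"
  have \<gamma>: "\<gamma> \<in># W" "\<forall>z\<in>#W. z \<le> \<gamma>"
    using \<open>W \<noteq> {#}\<close> by (auto simp: \<gamma>_def)
  \<comment> \<open>If \<open>W\<close> exceeded its leading term omega^\<gamma>, some first move
    \<open>c\<close> would leave rank at least omega^\<gamma> beside \<open>c\<close>, and a full
    copy of the cube above \<open>c\<close> would add \<open>W\<close> to it, more than the cube can
    hold.\<close>
  have "W = {#\<gamma>#}"
  proof (rule ccontr)
    assume "W \<noteq> {#\<gamma>#}"
    moreover have "{#\<gamma>#} \<le> W"
      using \<gamma>(1) by (simp add: subset_eq_imp_le_multiset)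
    ultimately have "{#\<gamma>#} < W" by simp
    then obtain c where c: "c \<in> cube n x" "wge ?le (residual ?le (cube n x) {c}) {#\<gamma>#}"
      using wgeD[OF W(2)] by blast
    let ?A = "residual ?le (cube n x) {c}"
    let ?B = "{f\<in>cube n x. ?le c f}"
    have B: "wge ?le ?B W"
    proof (rule wge_embed[OF W(2) order_refl])
      show "(\<lambda>f i. c i + f i) ` cube n x \<subseteq> ?B"
        using c(1) by (auto simp: box_def fle_def ball_Un)
    qed (auto simp: incomp_fle)
    have "wge ?le (?A \<union> ?B) ({#\<gamma>#} + W)"
    proof (rule wge_Un[OF c(2) B])
      show "mset_ge {#\<gamma>#} W" using \<gamma>(2) by (simp add: mset_ge_def)
    next
      fix F assume F: "finite F" "F \<subseteq> ?B"
      define s where "s = (\<lambda>i. \<Sum>f\<in>F. f i)"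
      \<comment> \<open>Coordinates below \<open>c\<close> stay, hence remain below every point of
        \<open>F\<close>, since these lie above \<open>c\<close>. The others are raised by
        \<open>s i\<close>; one strictly above \<open>c\<close> thereby passes all points of
        \<open>F\<close>. Strict monotonicity of \<open>\<phi> i\<close> preserves
        incomparability.\<close>
      define \<phi> where "\<phi> = (\<lambda>i z. if z < c i then z else z + s i)"
      have s: "s i < {#x i#}" if "i < n" for i
        unfolding s_def by (rule sum_less_single) (use F that in \<open>auto simp: box_def\<close>)
      have mono: "\<phi> i z < \<phi> i z'" if "z < z'" for i z z'
      proof (cases "z < c i \<and> \<not> z' < c i")
        case True
        have "z' \<le> z' + s i" by simp
        with that have "z < z' + s i" by (rule order.strict_trans2)
        then show ?thesis using True by (simp add: \<phi>_def)
      qed (use that in \<open>auto simp: \<phi>_def\<close>)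
      \<comment> \<open>\<open>c\<close> is included because the image must remain inside the
        residual of \<open>c\<close>.\<close>
      have "incomp ?le f (\<lambda>i. \<phi> i (g i))" if f: "f \<in> insert c F" and g: "g \<in> ?A" for f g
      proof -
        have cf: "\<forall>i<n. c i \<le> f i" using f F by (auto simp: fle_def)
        obtain i j where ij: "i < n" "g i < c i" "j < n" "c j < g j"
          using g unfolding residual_def incomp_fle by blast
        have 1: "\<phi> i (g i) < f i" using ij cf by (auto simp: \<phi>_def)
        have "f j < g j + s j"
        proof (cases "f = c")
          case True
          have "g j \<le> g j + s j" by simp
          with ij(4) show ?thesis unfolding True by (rule order.strict_trans2)
        next
          case False
          have "g j \<noteq> {#}" using ij(4) by auto
          then show ?thesis
            unfolding s_def using F(1) f False by (intro less_add_sum_member) auto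
        qed
        then have "f j < \<phi> j (g j)" using ij(4) by (auto simp: \<phi>_def)
        with 1 ij show ?thesis unfolding incomp_fle by blast
      qed
      moreover have "(\<lambda>i. \<phi> i (g i)) \<in> cube n x" if "g \<in> ?A" for g
        using that s by (auto simp: box_def residual_def \<phi>_def ball_Un)
      ultimately have "(\<lambda>g i. \<phi> i (g i)) ` ?A \<subseteq> residual ?le ?A F"
        unfolding residual_residual unfolding residual_def by auto
      then show "\<exists>h. h ` ?A \<subseteq> residual ?le ?A F \<and>
          (\<forall>f\<in>?A. \<forall>g\<in>?A. incomp ?le f g \<longrightarrow> incomp ?le (h f) (h g))"
        using mono by (intro exI[of _ "\<lambda>g i. \<phi> i (g i)"]) (auto simp: incomp_fle)
    qed
    then have "wge ?le (cube n x) ({#\<gamma>#} + W)"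
      by (rule wge_embed[where h = id]) (auto simp: residual_def)
    then have "{#\<gamma>#} + W \<le> W" using W(1) unfolding wge_def by blast
    then show False by simp
  qed
  then show ?thesis using that unfolding W_def by blast
qed


section \<open>Cutting a product into blocks\<close>

lemma block_less:
  fixes f g :: "nat \<Rightarrow> 'o::linorder multiset"
  assumes "f \<in> block n y p" "g \<in> block n y q" "i < n" "p i < q i"
  shows "f i < g i"
proof -
  obtain z z' where z: "z < {#y i (p i)#}" "f i = (\<Sum>j<p i. {#y i j#}) + z"
      and z': "g i = (\<Sum>j<q i. {#y i j#}) + z'"
    using assms(1-3) unfolding block_def by blast
  show ?thesis unfolding z(2) z'
    using sum_add_less[of "p i" "q i" z "\<lambda>j. {#y i j#}" z'] assms(4) z(1) by blast
qed

text \<open>A block is a translate of a cube by the sum of the earlier summands.\<close>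

lemma wle_cube_of_block:
  assumes "wle (fle n) (block n y p) K"
  shows "wle (fle n) (cube n (\<lambda>i. y i (p i))) K"
  by (rule wle_embed[OF assms order_refl, where h = "\<lambda>f i. (\<Sum>j<p i. {#y i j#}) + f i"])
    (auto simp: box_def block_def incomp_fle)

lemma wle_block_of_cube:
  assumes "wle (fle n) (cube n (\<lambda>i. y i (p i))) K"
  shows "wle (fle n) (block n y p) K"
proof (rule wle_embed[OF assms order_refl, where h = "\<lambda>f i. f i - (\<Sum>j<p i. {#y i j#})"])
  show "(\<lambda>f i. f i - (\<Sum>j<p i. {#y i j#})) ` block n y p \<subseteq> cube n (\<lambda>i. y i (p i))"
    by (force simp: box_def block_def)
next
  fix f g assume fg: "f \<in> block n y p" "g \<in> block n y p" "incomp (fle n) f g"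
  have "f' i - (\<Sum>j<p i. {#y i j#}) < g' i - (\<Sum>j<p i. {#y i j#})"
    if "f' \<in> block n y p" "g' \<in> block n y p" "i < n" "f' i < g' i" for f' g' i
    using that unfolding block_def by force
  then show "incomp (fle n) (\<lambda>i. f i - (\<Sum>j<p i. {#y i j#})) (\<lambda>i. g i - (\<Sum>j<p i. {#y i j#}))"
    using fg unfolding incomp_fle by blast
qed

text \<open>The \<open>i\<close>-th factor is the sum of the \<open>L i\<close> blocks \<open>\<omega>\<^bsup>y i j\<^esup>\<close>. Only the coordinates in \<open>J\<close> are
  known to start with an infinite block; \<open>J\<close> is a proper subset for the products \<open>X\<^sub>I\<close>.\<close>

locale staircase =
  fixes n :: nat and y :: "nat \<Rightarrow> nat \<Rightarrow> 'o::wellorder" and L :: "nat \<Rightarrow> nat" and J :: "nat set"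
  assumes decr: "\<And>i j k. i < n \<Longrightarrow> j \<le> k \<Longrightarrow> k < L i \<Longrightarrow> y i k \<le> y i j"
    and J: "J \<subseteq> {..<n}"
    and limit: "\<And>i. i \<in> J \<Longrightarrow> 0 < L i \<Longrightarrow> \<exists>b. b < y i 0"
    and bounded: "\<exists>K :: 'o multiset. wle (fle n) (box n (\<lambda>i. \<Sum>j<L i. {#y i j#})) K"
begin

abbreviation positions :: "(nat \<Rightarrow> nat) set" where
  "positions \<equiv> (\<Pi>\<^sub>E i\<in>{..<n}. {..<L i})"

text \<open>Only a zero in \<open>J\<close> counts: there the first block is infinite and leaves
  room for shifts.\<close>

definition frontier :: "(nat \<Rightarrow> nat) set" where
  "frontier = {p \<in> positions. \<exists>i\<in>J. p i = 0}"

definition cell_wd :: "(nat \<Rightarrow> nat) \<Rightarrow> 'o multiset" where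
  "cell_wd p = wd (fle n) (cube n (\<lambda>i. y i (p i)))"

lemma finite_frontier: "finite frontier"
  unfolding frontier_def by (simp add: finite_PiE)

lemma block_subset_box:
  assumes "p \<in> positions"
  shows "block n y p \<subseteq> box n (\<lambda>i. \<Sum>j<L i. {#y i j#})"
proof
  fix f assume f: "f \<in> block n y p"
  show "f \<in> box n (\<lambda>i. \<Sum>j<L i. {#y i j#})"
    unfolding box_def
  proof (intro CollectI allI impI)
    fix i assume "i < n"
    then obtain z where "z < {#y i (p i)#}" "f i = (\<Sum>j<p i. {#y i j#}) + z"
      using f unfolding block_def by blast
    moreover have "p i < L i" using assms \<open>i < n\<close> by auto
    ultimately show "f i < (\<Sum>j<L i. {#y i j#})"
      using sum_add_less[of "p i" "L i" z "\<lambda>j. {#y i j#}" "{#}"] by simp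
  qed
qed

lemma wle_cell:
  assumes "p \<in> positions"
  shows "wle (fle n) (cube n (\<lambda>i. y i (p i))) (cell_wd p)"
proof -
  obtain K :: "'o multiset" where "wle (fle n) (box n (\<lambda>i. \<Sum>j<L i. {#y i j#})) K"
    using bounded by blast
  then have "wle (fle n) (block n y p) K"
    by (rule wle_mono[OF _ order_refl block_subset_box[OF assms]])
  then show ?thesis
    unfolding cell_wd_def by (rule wle_wd[OF wle_cube_of_block])
qed

text \<open>Exponents weakly decrease along each factor, so a larger position gives a smaller
  cube.\<close>

lemma cell_mono:
  assumes "p \<in> positions" "q \<in> positions" "\<And>i. i < n \<Longrightarrow> p i \<le> q i"
  shows "wle (fle n) (cube n (\<lambda>i. y i (q i))) (cell_wd p)" "cell_wd q \<le> cell_wd p"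
proof -
  have "cube n (\<lambda>i. y i (q i)) \<subseteq> cube n (\<lambda>i. y i (p i))"
  proof (rule box_mono)
    fix i assume "i < n"
    then have "y i (q i) \<le> y i (p i)" using assms by (intro decr) auto
    then show "{#y i (q i)#} \<le> {#y i (p i)#}" by (auto simp: order.order_iff_strict)
  qed
  then show "wle (fle n) (cube n (\<lambda>i. y i (q i))) (cell_wd p)"
    by (rule wle_mono[OF wle_cell[OF assms(1)] order_refl])
  then show "cell_wd q \<le> cell_wd p"
    unfolding cell_wd_def[of q] by (rule wd_le)
qed

text \<open>Each position slides down its diagonal by a smallest coordinate lying in
  \<open>J\<close> and ends on the frontier. A diagonal costs only the width of its frontier cell,
  and the finitely many diagonals add up naturally.\<close>

lemma wle_box:
  assumes diagonal: "\<And>p. p \<in> positions \<Longrightarrow> \<exists>i\<in>J. \<forall>j<n. p i \<le> p j"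
  shows "wle (fle n) (box n (\<lambda>i. \<Sum>j<L i. {#y i j#})) (\<Sum>p\<in>frontier. cell_wd p)"
proof -
  \<comment> \<open>\<open>restrict\<close> keeps shifted positions extensional; \<open>D p\<close>
    covers the part of the diagonal through \<open>p\<close> that stays inside
    \<open>positions\<close>.\<close>
  define shift where "shift = (\<lambda>p k. \<lambda>i\<in>{..<n}. p i + k :: nat)"
  define D where "D = (\<lambda>p. \<Union>k\<in>{k. shift p k \<in> positions}. block n y (shift p k))"
  have "wle (fle n) (D p) (cell_wd p)" if "p \<in> frontier" for p
    unfolding D_def
  proof (rule wle_comparable_UN)
    fix k assume "k \<in> {k. shift p k \<in> positions}"
    then show "wle (fle n) (block n y (shift p k)) (cell_wd p)"
      using that by (intro wle_block_of_cube cell_mono(1)) (auto simp: frontier_def shift_def)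
  next
    fix k l f g
    assume "k \<noteq> l" "f \<in> block n y (shift p k)" "g \<in> block n y (shift p l)"
    then have "(\<forall>i<n. f i < g i) \<or> (\<forall>i<n. g i < f i)"
      using block_less[of f n y "shift p k" g "shift p l"] block_less[of g n y "shift p l" f "shift p k"]
      by (cases "k < l") (auto simp: shift_def)
    then show "\<not> incomp (fle n) f g"
      unfolding incomp_def fle_def by (auto intro: less_imp_le)
  qed
  then have "wle (fle n) (\<Union>p\<in>frontier. D p) (\<Sum>p\<in>frontier. cell_wd p)"
    by (rule wle_UN[OF finite_frontier])
  moreover have "box n (\<lambda>i. \<Sum>j<L i. {#y i j#}) \<subseteq> (\<Union>p\<in>frontier. D p)"
  proof
    fix f assume f: "f \<in> box n (\<lambda>i. \<Sum>j<L i. {#y i j#})"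
    have "\<exists>j<L i. \<exists>z<{#y i j#}. f i = (\<Sum>k<j. {#y i k#}) + z" if "i < n" for i
      by (rule less_sum_cases) (use f that decr in \<open>auto simp: box_def mset_ge_def\<close>)
    then obtain q where q: "\<And>i. i < n \<Longrightarrow> q i < L i \<and> (\<exists>z<{#y i (q i)#}. f i = (\<Sum>k<q i. {#y i k#}) + z)"
      by metis
    have "restrict q {..<n} \<in> positions" using q by auto
    then obtain i where i: "i \<in> J" "\<forall>j<n. q i \<le> q j"
      using diagonal[of "restrict q {..<n}"] J by auto
    \<comment> \<open>The point where the diagonal through \<open>q\<close> meets the frontier,
      \<open>q i\<close> being the smallest coordinate.\<close>
    define p where "p = (\<lambda>j\<in>{..<n}. q j - q i)"
    have "p \<in> frontier"
      using q i J unfolding frontier_def p_def by (auto intro: le_less_trans[OF diff_le_self])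
    moreover have "shift p (q i) = restrict q {..<n}"
      using i(2) by (auto simp: shift_def p_def restrict_def fun_eq_iff)
    moreover have "f \<in> block n y (restrict q {..<n})"
      using q by (simp add: block_def)
    ultimately show "f \<in> (\<Union>p\<in>frontier. D p)"
      using \<open>restrict q {..<n} \<in> positions\<close> unfolding D_def by (metis (no_types, lifting) UN_I mem_Collect_eq)
  qed
  ultimately show ?thesis
    using wle_mono by blast
qed

text \<open>A played point \<open>g\<close> already exceeds every point of block \<open>p\<close> in
  one coordinate. To become incomparable to it, the copy of the block is raised above
  \<open>g\<close> in a coordinate of \<open>J\<close> where both positions are 0, unless the
  position of \<open>g\<close> is lower somewhere anyway.\<close>

lemma cell_survives:
  assumes p: "p \<in> positions" and F: "finite F"
    and sep: "\<And>g. g \<in> F \<Longrightarrow> \<exists>q\<in>frontier. g \<in> block n y q \<and> (\<exists>i<n. p i < q i)"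
  shows "\<exists>h. h ` block n y p \<subseteq> residual (fle n) (block n y p) F \<and>
    (\<forall>f\<in>block n y p. \<forall>g\<in>block n y p. incomp (fle n) f g \<longrightarrow> incomp (fle n) (h f) (h g))"
proof -
  \<comment> \<open>An exponent below \<open>y i 0\<close>, available because the first block is
    infinite; \<open>{#b i#}\<close> is the nonzero term that makes the shift strict.\<close>
  define b where "b = (\<lambda>i. SOME b. b < y i 0)"
  have b: "b i < y i 0" if "i \<in> J" "p i = 0" for i
  proof -
    have "i < n" using J that(1) by blast
    then have "p i < L i" using p by auto
    then have "\<exists>b. b < y i 0" using limit[OF that(1)] that(2) by simp
    then show ?thesis unfolding b_def by (rule someI_ex)
  qed
  \<comment> \<open>Only played values from the first block are summed: their sum stays below
    \<open>{#y i 0#}\<close>, so the shift does not leave the block.\<close>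
  define s where "s = (\<lambda>i. if i \<in> J \<and> p i = 0
      then {#b i#} + (\<Sum>g\<in>{g\<in>F. g i < {#y i 0#}}. g i) else {#})"
  have s: "s i < {#y i (p i)#}" for i
  proof (cases "i \<in> J \<and> p i = 0")
    case True
    have "(\<Sum>g\<in>{g\<in>F. g i < {#y i 0#}}. g i) < {#y i 0#}"
      by (rule sum_less_single) blast
    then have "{#b i#} + (\<Sum>g\<in>{g\<in>F. g i < {#y i 0#}}. g i) < {#y i 0#}"
      unfolding add_less_single
    proof (intro conjI)
      show "{#b i#} < {#y i 0#}" using b[of i] True by simp
    qed
    moreover have "p i = 0" "s i = {#b i#} + (\<Sum>g\<in>{g\<in>F. g i < {#y i 0#}}. g i)"
      using True unfolding s_def by (simp_all only: simp_thms if_True)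
    ultimately show ?thesis by (simp only:)
  qed (auto simp: s_def)
  define h where "h = (\<lambda>f i. f i + s i)"
  have h: "h f \<in> block n y p" if f: "f \<in> block n y p" for f
    unfolding block_def
  proof (intro CollectI allI impI)
    fix i assume "i < n"
    then obtain z where "z < {#y i (p i)#}" "f i = (\<Sum>j<p i. {#y i j#}) + z"
      using f unfolding block_def by blast
    then show "\<exists>z<{#y i (p i)#}. h f i = (\<Sum>j<p i. {#y i j#}) + z"
      using s[of i] by (intro exI[of _ "z + s i"]) (simp only: h_def add_less_single add.assoc simp_thms)
  qed
  have "incomp (fle n) g (h f)" if g: "g \<in> F" and f: "f \<in> block n y p" for f g
  proof -
    obtain q i where q: "q \<in> frontier" "g \<in> block n y q" "i < n" "p i < q i"
      using sep[OF g] by blast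
    have "h f i < g i" by (rule block_less[OF h[OF f] q(2-4)])
    moreover have "\<exists>j<n. g j < h f j"
    proof (cases "\<exists>j<n. q j < p j")
      case True
      then show ?thesis using block_less[OF q(2) h[OF f]] by blast
    next
      case False
      obtain j where j: "j \<in> J" "q j = 0" using q(1) unfolding frontier_def by blast
      then have "j < n" using J by blast
      with False j have pj: "p j = 0" by auto
      have "g j < {#y j 0#}" using q(2) \<open>j < n\<close> j(2) unfolding block_def by force
      then have "g j < (f j + {#b j#}) + (\<Sum>g\<in>{g\<in>F. g j < {#y j 0#}}. g j)"
        using g F by (intro less_add_sum_member) auto
      also have "\<dots> = h f j" using j pj unfolding h_def s_def by (simp add: add.assoc)
      finally show ?thesis using \<open>j < n\<close> by blast
    qed
    ultimately show ?thesis using q(3) unfolding incomp_fle by blast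
  qed
  then have "h ` block n y p \<subseteq> residual (fle n) (block n y p) F"
    using h unfolding residual_def by blast
  then show ?thesis by (intro exI[of _ h]) (auto simp: incomp_fle h_def)
qed

text \<open>Among the cells of maximal width one of minimal height is played last.\<close>

lemma wge_frontier:
  assumes "T \<subseteq> frontier"
  shows "wge (fle n) (\<Union>p\<in>T. block n y p) (\<Sum>p\<in>T. cell_wd p)"
  using assms
proof (induction "card T" arbitrary: T rule: less_induct)
  case less
  have fin: "finite T" using less.prems finite_frontier finite_subset by blast
  show ?case
  proof (cases "T = {}")
    case False
    define m where "m = Max (cell_wd ` T)"
    have m: "m \<in> cell_wd ` T" "\<And>q. q \<in> T \<Longrightarrow> cell_wd q \<le> m"
      unfolding m_def using fin False by auto
    then obtain p0 where "p0 \<in> T \<and> cell_wd p0 = m" by blast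
    then obtain p where p: "p \<in> T" "cell_wd p = m"
        and min: "\<And>q. q \<in> T \<Longrightarrow> cell_wd q = m \<Longrightarrow> (\<Sum>i<n. p i) \<le> (\<Sum>i<n. q i)"
      using ex_has_least_nat[of "\<lambda>q. q \<in> T \<and> cell_wd q = m" p0 "\<lambda>q. \<Sum>i<n. q i"] by blast
    have pos: "q \<in> positions" if "q \<in> T" for q
      using that less.prems unfolding frontier_def by blast
    \<comment> \<open>If \<open>q\<close> nowhere exceeded \<open>p\<close>,
      \<open>cell_mono\<close> would give it maximal width too, and the minimal height of
      \<open>p\<close> would force \<open>q = p\<close>.\<close>
    have above: "\<exists>i<n. p i < q i" if q: "q \<in> T - {p}" for q
    proof (rule ccontr)
      assume "\<not> (\<exists>i<n. p i < q i)"
      then have le: "q i \<le> p i" if "i < n" for i using that by (meson not_le)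
      have "cell_wd p \<le> cell_wd q"
        using q p pos le by (intro cell_mono(2)) auto
      then have "cell_wd q = m" using m(2)[of q] q p(2) by auto
      then have "(\<Sum>i<n. p i) \<le> (\<Sum>i<n. q i)" using min q by blast
      moreover have "(\<Sum>i<n. q i) \<le> (\<Sum>i<n. p i)" using le by (intro sum_mono) auto
      ultimately have "(\<Sum>i<n. q i) = (\<Sum>i<n. p i)" by simp
      then have "q i = p i" if "i < n" for i
        using sum_mono_inv[of q "{..<n}" p i] le that by auto
      then have "q = p"
        using pos[OF p(1)] pos[of q] q by (intro PiE_ext[of q "{..<n}" "\<lambda>i. {..<L i}" p]) auto
      then show False using q by blast
    qed
    have single: "\<exists>\<gamma>. cell_wd q = {#\<gamma>#}" if "q \<in> T" for q
      using wd_cube_single[OF wle_cell[OF pos[OF that]]] unfolding cell_wd_def by blast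
    have "wge (fle n) (block n y p \<union> (\<Union>q\<in>T - {p}. block n y q))
        (cell_wd p + (\<Sum>q\<in>T - {p}. cell_wd q))"
    proof (rule wge_Un)
      show "wge (fle n) (block n y p) (cell_wd p)"
        unfolding wge_def cell_wd_def using wd_le[OF wle_cube_of_block] by blast
      show "wge (fle n) (\<Union>q\<in>T - {p}. block n y q) (\<Sum>q\<in>T - {p}. cell_wd q)"
        by (rule less.hyps[OF card_Diff1_less[OF fin p(1)]]) (use less.prems in blast)
      \<comment> \<open>Cell widths are single powers of omega, so comparing them compares their
        exponents.\<close>
      show "mset_ge (cell_wd p) (\<Sum>q\<in>T - {p}. cell_wd q)"
      proof (rule mset_ge_sum_right)
        fix q assume "q \<in> T - {p}"
        then have "cell_wd q \<le> cell_wd p" "q \<in> T" using m(2) p(2) by auto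
        moreover obtain \<gamma> \<delta> where "cell_wd q = {#\<gamma>#}" "cell_wd p = {#\<delta>#}"
          using single \<open>q \<in> T\<close> p(1) by metis
        ultimately show "mset_ge (cell_wd p) (cell_wd q)"
          by (auto simp: mset_ge_def order.order_iff_strict)
      qed
    next
      fix F assume "finite F" "F \<subseteq> (\<Union>q\<in>T - {p}. block n y q)"
      then show "\<exists>h. h ` block n y p \<subseteq> residual (fle n) (block n y p) F \<and>
          (\<forall>f\<in>block n y p. \<forall>g\<in>block n y p. incomp (fle n) f g \<longrightarrow> incomp (fle n) (h f) (h g))"
        using above less.prems by (intro cell_survives pos[OF p(1)]) blast+
    qed
    moreover have "block n y p \<union> (\<Union>q\<in>T - {p}. block n y q) = (\<Union>q\<in>T. block n y q)"
      using p(1) by blast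
    ultimately show ?thesis by (simp add: sum.remove[OF fin p(1)])
  qed (simp add: wge_def)
qed

theorem wd_box:
  assumes "\<And>p. p \<in> positions \<Longrightarrow> \<exists>i\<in>J. \<forall>j<n. p i \<le> p j"
  shows "wd (fle n) (box n (\<lambda>i. \<Sum>j<L i. {#y i j#})) = (\<Sum>p\<in>frontier. cell_wd p)"
proof (rule wd_eqI[OF wle_box[OF assms]])
  show "wge (fle n) (box n (\<lambda>i. \<Sum>j<L i. {#y i j#})) (\<Sum>p\<in>frontier. cell_wd p)"
  proof (rule wge_embed[OF wge_frontier[OF order_refl] order_refl, where h = id])
    show "id ` (\<Union>p\<in>frontier. block n y p) \<subseteq> box n (\<lambda>i. \<Sum>j<L i. {#y i j#})"
      using block_subset_box unfolding frontier_def by auto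
  qed simp
qed

end

section \<open>Well-orders as multisets\<close>

unbundle cardinal_syntax

text \<open>The ordinal \<open>m\<close> as a relation: \<open>r =o below m\<close> says that
  \<open>r\<close> has order type \<open>m\<close>. If \<open>m\<close> is a multiset, it is the
  Cantor normal form of that type.\<close>

definition below :: "'o::wellorder \<Rightarrow> 'o rel" where
  "below m = {(a, b). a \<le> b \<and> b < m}"

lemma Field_below [simp]: "Field (below m) = {..<m}"
  unfolding below_def Field_def by fastforce

lemma Well_order_order_rel: "Well_order {(a, b :: 'o::wellorder). a \<le> b}"
proof -
  have F: "Field {(a, b :: 'o). a \<le> b} = UNIV"
    unfolding Field_def by auto
  have "{(a, b :: 'o). a \<le> b} - Id = {(a, b). a < b}" by auto
  then have "wf ({(a, b :: 'o). a \<le> b} - Id)" by (simp add: wf)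
  then show ?thesis
    unfolding well_order_on_def linear_order_on_def partial_order_on_def preorder_on_def F
    by (auto simp: refl_on_def trans_def antisym_def total_on_def)
qed

lemma below_eq_Restr: "below m = Restr {(a, b). a \<le> b} (underS {(a, b). a \<le> b} m)"
  unfolding below_def underS_def by auto

lemma Well_order_below: "Well_order (below m)"
  unfolding below_eq_Restr by (rule Well_order_Restr[OF Well_order_order_rel])

lemma ordIso_belowI:
  assumes f: "bij_betw f (Field r) {..<m}"
    and iff: "\<And>a b. a \<in> Field r \<Longrightarrow> b \<in> Field r \<Longrightarrow> (a, b) \<in> r \<longleftrightarrow> f a \<le> f b"
  shows "r =o below m"
proof -
  define g where "g = inv_into (Field r) f"
  have g: "bij_betw g {..<m} (Field r)"
    unfolding g_def by (rule bij_betw_inv_into[OF f])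
  have gf: "g (f a) = a" if "a \<in> Field r" for a
    unfolding g_def using bij_betw_inv_into_left[OF f that] .
  have fg: "f (g u) = u" if "u < m" for u
    unfolding g_def using bij_betw_inv_into_right[OF f] that by simp
  have fm: "f a < m" if "a \<in> Field r" for a
    using bij_betwE[OF f] that by auto
  have gm: "g u \<in> Field r" if "u < m" for u
    using bij_betwE[OF g] that by auto
  have "r = dir_image (below m) g"
  proof (intro equalityI subrelI)
    fix a b assume ab: "(a, b) \<in> r"
    then have F: "a \<in> Field r" "b \<in> Field r" by (auto simp: Field_def)
    then have "(f a, f b) \<in> below m" using iff ab fm by (simp add: below_def)
    then have "(g (f a), g (f b)) \<in> dir_image (below m) g" unfolding dir_image_def by blast
    then show "(a, b) \<in> dir_image (below m) g" using gf F by simp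
  next
    fix a b assume "(a, b) \<in> dir_image (below m) g"
    then obtain u v where uv: "a = g u" "b = g v" "u \<le> v" "v < m"
      unfolding dir_image_def below_def by blast
    then have "u < m" by simp
    with uv show "(a, b) \<in> r" using iff[of a b] gm fg by simp
  qed
  moreover have "inj_on g (Field (below m))"
    using g by (simp add: bij_betw_def)
  ultimately show ?thesis
    using dir_image_ordIso[OF Well_order_below] ordIso_symmetric by metis
qed

lemma ordIso_belowE:
  assumes "r =o below m"
  obtains f where "bij_betw f (Field r) {..<m}"
    "\<And>a b. a \<in> Field r \<Longrightarrow> b \<in> Field r \<Longrightarrow> (a, b) \<in> r \<longleftrightarrow> f a \<le> f b"
proof -
  obtain f where f: "iso r (below m) f"
    using assms unfolding ordIso_def by blast
  then have *: "bij_betw f (Field r) {..<m}"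
    "\<And>a b. a \<in> Field r \<Longrightarrow> b \<in> Field r \<Longrightarrow> (a, b) \<in> r \<longleftrightarrow> (f a, f b) \<in> below m"
    unfolding iso_iff2 by auto
  moreover have "(f a, f b) \<in> below m \<longleftrightarrow> f a \<le> f b" if "b \<in> Field r" for a b
    using bij_betwE[OF *(1)] that by (auto simp: below_def)
  ultimately show ?thesis using that by metis
qed

lemma ordLess_below_imp:
  assumes "r <o below m"
  obtains m' where "m' < m" "r =o below m'"
proof -
  have "Well_order r" using assms unfolding ordLess_def by auto
  then obtain m' where m': "m' < m" "r =o Restr (below m) (underS (below m) m')"
    using assms ordLess_iff_ordIso_Restr[OF Well_order_below] by (metis Field_below lessThan_iff)
  moreover have "Restr (below m) (underS (below m) m') = below m'"
    using m'(1) unfolding below_def underS_def by auto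
  ultimately show ?thesis using that by simp
qed

lemma below_ordLess:
  assumes "m < m'"
  shows "below m <o below m'"
proof -
  have "Restr (below m') (underS (below m') m) = below m"
    using assms unfolding below_def underS_def by auto
  moreover have "Field (below m') \<noteq> {}" using assms by auto
  ultimately show ?thesis
    using underS_Restr_ordLess[OF Well_order_below] by metis
qed

lemma below_ordLeq: "m \<le> m' \<Longrightarrow> below m \<le>o below m'"
  using below_ordLess ordLess_imp_ordLeq ordLeq_reflexive[OF Well_order_below]
  by (metis order.order_iff_strict)

lemma below_ordLess_imp: "below m <o below m' \<Longrightarrow> m < m'"
  using below_ordLeq not_ordLess_ordLeq by (metis not_le)

text \<open>The order of a type of larger cardinality cannot embed into \<open>r\<close>, so
  \<open>r\<close> is isomorphic to a proper initial segment of it.\<close>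

lemma ex_below:
  fixes r :: "'b rel"
  assumes "Well_order r" "|UNIV :: 'b set| <o |UNIV :: ('o::wellorder) set|"
  obtains m :: "'o::wellorder" where "r =o below m"
proof -
  let ?o = "{(a, b :: 'o). a \<le> b}"
  have F: "Field ?o = UNIV" unfolding Field_def by auto
  have "\<not> ?o \<le>o r"
  proof
    assume "?o \<le>o r"
    then have "|UNIV :: 'o set| \<le>o |Field r|"
      using card_of_mono2[of ?o r] F by simp
    also have "|Field r| \<le>o |UNIV :: 'b set|" by (rule card_of_mono1) simp
    finally show False using assms(2) not_ordLess_ordLeq by blast
  qed
  then have "r <o ?o"
    using not_ordLeq_iff_ordLess[OF assms(1) Well_order_order_rel] by blast
  then show ?thesis
    using that ordLess_iff_ordIso_Restr[OF Well_order_order_rel assms(1)]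
    by (auto simp flip: below_eq_Restr)
qed

text \<open>\<open>'a suc\<close> carries the successor cardinal of \<open>'a\<close>, so its small subsets are bounded.\<close>

instantiation suc :: (type) wellorder
begin

definition less_eq_suc :: "'a suc \<Rightarrow> 'a suc \<Rightarrow> bool" where
  "x \<le> y \<longleftrightarrow> (x, y) \<in> card_suc |UNIV :: 'a set|"

definition less_suc :: "'a suc \<Rightarrow> 'a suc \<Rightarrow> bool" where
  "x < y \<longleftrightarrow> x \<le> y \<and> x \<noteq> (y :: 'a suc)"

instance
proof
  have wo: "Well_order (card_suc |UNIV :: 'a set| )"
    using Card_order_card_suc[OF card_of_card_order_on] card_order_on_well_order_on by blast
  then have refl: "(x, x) \<in> card_suc |UNIV :: 'a set|" for x
    unfolding order_on_defs refl_on_def by (simp add: Field_card_suc)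
  have anti: "antisym (card_suc |UNIV :: 'a set| )" and trans: "trans (card_suc |UNIV :: 'a set| )"
    and total: "total_on UNIV (card_suc |UNIV :: 'a set| )" and wf: "wf (card_suc |UNIV :: 'a set| - Id)"
    using wo unfolding order_on_defs by (simp_all add: Field_card_suc)
  fix x y z :: "'a suc"
  show "x \<le> x" using refl by (simp add: less_eq_suc_def)
  show anti': "x = y" if "x \<le> y" "y \<le> x"
    using that anti by (auto simp: less_eq_suc_def antisym_def)
  show "x \<le> z" if "x \<le> y" "y \<le> z"
    using that trans by (auto simp: less_eq_suc_def trans_def)
  show "x \<le> y \<or> y \<le> x"
    using total refl unfolding less_eq_suc_def total_on_def by (metis UNIV_I)
  show "x < y \<longleftrightarrow> x \<le> y \<and> \<not> y \<le> x"
    using anti refl by (auto simp: less_eq_suc_def less_suc_def antisym_def)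
  show "P x" if "\<And>x. (\<And>y. y < x \<Longrightarrow> P y) \<Longrightarrow> P x" for P
    using wf
  proof (induction x rule: wf_induct_rule)
    case (less x)
    then show ?case using that[of x] by (simp add: less_suc_def less_eq_suc_def)
  qed
qed

end

section \<open>Small subsets of the successor type, and existence of widths\<close>

lemma card_of_UNIV_suc: "|UNIV :: 'a set| <o |UNIV :: 'a suc set|"
proof -
  have "card_suc |UNIV :: 'a set| =o |UNIV :: 'a suc set|"
    using card_of_unique[OF card_order_card_suc[OF card_of_card_order_on]] by blast
  then show ?thesis
    using ordLess_ordIso_trans[OF card_suc_greater[OF card_of_card_order_on]] by blast
qed

lemma card_of_lessThan_suc: "|{..<s :: 'a suc}| \<le>o |UNIV :: 'a set|"
proof -
  let ?c = "card_suc |UNIV :: 'a set|"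
  have "{..<s} = underS ?c s"
    by (auto simp: underS_def less_suc_def less_eq_suc_def)
  then have "|{..<s}| <o ?c"
    using card_of_underS[OF Card_order_card_suc[OF card_of_card_order_on]] by (simp add: Field_card_suc)
  then have "|{..<s}| <o cardSuc |UNIV :: 'a set|"
    using ordLess_ordIso_trans ordIso_symmetric cardSuc_ordIso_card_suc[OF card_of_card_order_on] by blast
  then show ?thesis
    using cardSuc_ordLeq_ordLess[OF card_of_Card_order card_of_Card_order] by blast
qed

lemma card_of_finite_ordLeq: "finite A \<Longrightarrow> infinite B \<Longrightarrow> |A| \<le>o |B|"
  by (intro ordLess_imp_ordLeq finite_ordLess_infinite) (simp_all add: card_of_well_order_on Field_card_of)

text \<open>Regularity of the successor cardinal: a cofinal \<open>S\<close> would make the whole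
  type a union of at most \<open>|UNIV :: 'a set|\<close> initial segments of at most that
  size.\<close>

lemma suc_strict_upper_bound:
  fixes S :: "'a suc set"
  assumes "infinite (UNIV :: 'a set)" "|S| \<le>o |UNIV :: 'a set|"
  obtains z where "\<And>s. s \<in> S \<Longrightarrow> s < z"
proof (rule ccontr)
  assume "\<not> thesis"
  then have unb: "\<exists>s\<in>S. z \<le> s" for z using that by (meson not_le)
  have "|{..s}| \<le>o |UNIV :: 'a set|" for s :: "'a suc"
  proof -
    have eq: "{..s} = {..<s} \<union> {s}" by auto
    show ?thesis
      unfolding eq
      by (rule card_of_Un_ordLeq_infinite_Field[OF _ card_of_lessThan_suc
            card_of_finite_ordLeq[OF _ assms(1)] card_of_Card_order])
        (simp_all add: Field_card_of assms(1))
  qed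
  then have "|\<Union>s\<in>S. {..s}| \<le>o |UNIV :: 'a set|"
    by (intro card_of_UNION_ordLeq_infinite[OF assms]) blast
  moreover have "(\<Union>s\<in>S. {..s}) = UNIV" using unb by auto
  ultimately show False using card_of_UNIV_suc not_ordLess_ordLeq by metis
qed

text \<open>One \<open>z\<close> strictly bounds all exponents that occur; then \<open>{#z#}\<close>
  exceeds every \<open>g i\<close>.\<close>

lemma suc_mset_strict_upper_bound:
  fixes g :: "'i \<Rightarrow> 'a suc multiset"
  assumes "infinite (UNIV :: 'a set)" "|I| \<le>o |UNIV :: 'a set|"
  obtains M where "\<And>i. i \<in> I \<Longrightarrow> g i < M"
proof -
  have "|set_mset (g i)| \<le>o |UNIV :: 'a set|" for i
    by (rule card_of_finite_ordLeq[OF _ assms(1)]) simp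
  then have "|\<Union>i\<in>I. set_mset (g i)| \<le>o |UNIV :: 'a set|"
    by (intro card_of_UNION_ordLeq_infinite[OF assms]) blast
  then obtain z where z: "\<And>s. s \<in> (\<Union>i\<in>I. set_mset (g i)) \<Longrightarrow> s < z"
    using suc_strict_upper_bound[OF assms(1)] by blast
  show ?thesis by (rule that[of "{#z#}"]) (use z in auto)
qed

text \<open>Ensures that the width fits into the type. After a first move \<open>x\<close>, each
  remaining point is below \<open>x\<close> in some coordinate, so the residual is covered by
  \<open>n\<close> boxes with one side shortened; the induction is on the natural sum of the
  sides.\<close>

lemma wle_box_exists:
  fixes M :: "nat \<Rightarrow> 'a suc multiset"
  assumes "infinite (UNIV :: 'a set)" "|\<Pi>\<^sub>E i\<in>{..<n}. {..<M i}| \<le>o |UNIV :: 'a set|"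
  shows "\<exists>K :: 'a suc multiset. wle (fle n) (box n M) K"
  using assms(2)
proof (induction "\<Sum>i<n. M i" arbitrary: M rule: less_induct)
  case less
  let ?P = "\<Pi>\<^sub>E i\<in>{..<n}. {..<M i}"
  have "\<exists>K :: 'a suc multiset. wle (fle n) (box n (M(i := x i))) K"
    if x: "x \<in> box n M" and i: "i < n" for x i
  proof (rule less.hyps)
    have "x i < M i" using x i by (simp add: box_def)
    then have le: "(M(i := x i)) j \<le> M j" for j by (simp add: less_imp_le)
    have "(\<Sum>j<n. (M(i := x i)) j) = x i + (\<Sum>j\<in>{..<n} - {i}. M j)"
      using i sum.remove[of "{..<n}" i "M(i := x i)"] by simp
    also have "\<dots> < M i + (\<Sum>j\<in>{..<n} - {i}. M j)" using \<open>x i < M i\<close> by simp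
    also have "\<dots> = (\<Sum>j<n. M j)" using i sum.remove[of "{..<n}" i M] by simp
    finally show "(\<Sum>j<n. (M(i := x i)) j) < (\<Sum>j<n. M j)" .
    have "(\<Pi>\<^sub>E j\<in>{..<n}. {..<(M(i := x i)) j}) \<subseteq> ?P"
      by (rule PiE_mono) (use le in \<open>auto intro: order.strict_trans2\<close>)
    then show "|\<Pi>\<^sub>E j\<in>{..<n}. {..<(M(i := x i)) j}| \<le>o |UNIV :: 'a set|"
      using less.prems card_of_mono1 ordLeq_transitive by blast
  qed
  then obtain k :: "(nat \<Rightarrow> 'a suc multiset) \<Rightarrow> nat \<Rightarrow> 'a suc multiset" where
    k: "\<And>x i. x \<in> box n M \<Longrightarrow> i < n \<Longrightarrow> wle (fle n) (box n (M(i := x i))) (k x i)"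
    by metis
  \<comment> \<open>The bounds for all first moves need a common strict bound. Ranging over
    extensional functions keeps the number of moves within the allowed cardinality.\<close>
  obtain K where K: "\<And>x. x \<in> ?P \<Longrightarrow> (\<Sum>i<n. k x i) < K"
    using suc_mset_strict_upper_bound[OF assms(1) less.prems, of "\<lambda>x. \<Sum>i<n. k x i"] by blast
  have "wle (fle n) (box n M) K"
  proof (rule wleI)
    fix x assume x: "x \<in> box n M"
    let ?x = "restrict x {..<n}"
    have x': "?x \<in> box n M" "?x \<in> ?P" using x by (auto simp: box_def)
    have "wle (fle n) (\<Union>i\<in>{..<n}. box n (M(i := ?x i))) (\<Sum>i<n. k ?x i)"
      by (rule wle_UN) (use k[OF x'(1)] in auto)
    moreover have "residual (fle n) (box n M) {x} \<subseteq> (\<Union>i\<in>{..<n}. box n (M(i := ?x i)))"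
    proof
      fix f assume f: "f \<in> residual (fle n) (box n M) {x}"
      then obtain i where i: "i < n" "f i < x i"
        unfolding residual_def incomp_fle by blast
      have "f \<in> box n (M(i := ?x i))"
        using f i by (auto simp: residual_def box_def)
      then show "f \<in> (\<Union>i\<in>{..<n}. box n (M(i := ?x i)))" using i(1) by blast
    qed
    ultimately have "wle (fle n) (residual (fle n) (box n M) {x}) (\<Sum>i<n. k ?x i)"
      using wle_mono by blast
    then show "\<exists>N<K. wle (fle n) (residual (fle n) (box n M) {x}) N"
      using K[OF x'(2)] by blast
  qed
  then show ?case by blast
qed

section \<open>Widths and normal forms of well-orders\<close>

lemma antichain_seqs_alt:
  "antichain_seqs A le = {xs. xs \<noteq> [] \<and> set xs \<subseteq> A \<and> sorted_wrt (incomp le) xs}"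
  unfolding antichain_seqs_def sorted_wrt_iff_nth_less incomp_def
  by (rule Collect_cong) (metis linorder_neqE_nat less_irrefl order.strict_trans)

lemma antichain_extend:
  assumes "sorted_wrt (incomp le) xs" "set xs \<subseteq> A" "x \<in> residual le A (set xs)"
  shows "xs @ [x] \<in> antichain_seqs A le"
  using assms unfolding antichain_seqs_alt residual_def by (auto simp: sorted_wrt_append)

lemma residual_snoc: "residual le A (set (xs @ [x])) = residual le (residual le A (set xs)) {x}"
  by (simp add: residual_residual)

text \<open>The label of a node bounds the rank of what remains playable after it.\<close>

lemma wle_of_decreasing:
  assumes g: "\<And>xs. xs \<in> antichain_seqs A le \<Longrightarrow> g xs < (m :: 'o::wellorder)"
    and dec: "\<And>xs zs. xs \<in> antichain_seqs A le \<Longrightarrow> xs @ zs \<in> antichain_seqs A le \<Longrightarrow> zs \<noteq> [] \<Longrightarrow>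
      g (xs @ zs) < g xs"
  shows "wle le A m"
proof -
  have "wle le (residual le A (set xs)) k"
    if "sorted_wrt (incomp le) xs" "set xs \<subseteq> A"
      "\<And>zs. zs \<noteq> [] \<Longrightarrow> xs @ zs \<in> antichain_seqs A le \<Longrightarrow> g (xs @ zs) < k" for xs k
    using that
  proof (induction k arbitrary: xs rule: less_induct)
    case (less k)
    show ?case
    proof (rule wleI)
      fix x assume x: "x \<in> residual le A (set xs)"
      have xsx: "xs @ [x] \<in> antichain_seqs A le"
        by (rule antichain_extend[OF less.prems(1,2) x])
      have "wle le (residual le A (set (xs @ [x]))) (g (xs @ [x]))"
      proof (rule less.IH)
        show "g (xs @ [x]) < k" using less.prems(3)[of "[x]"] xsx by simp
        show "sorted_wrt (incomp le) (xs @ [x])" "set (xs @ [x]) \<subseteq> A"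
          using xsx unfolding antichain_seqs_alt by blast+
        show "g ((xs @ [x]) @ zs) < g (xs @ [x])"
          if "zs \<noteq> []" "(xs @ [x]) @ zs \<in> antichain_seqs A le" for zs
          using dec[OF xsx] that by blast
      qed
      then show "\<exists>N<k. wle le (residual le (residual le A (set xs)) {x}) N"
        unfolding residual_snoc using less.prems(3)[of "[x]"] xsx by blast
    qed
  qed
  from this[of "[]" m] g show ?thesis by simp
qed

text \<open>Each antichain sequence is labelled by the width of its residual. The labels decrease
  along extensions and attain every value below \<open>wd le A\<close>, so they form a least rank
  function.\<close>

lemma width_ordIso_wd:
  fixes A :: "'b set" and K :: "'o::wellorder"
  assumes "wle le A K"
  shows "width A le =o below (wd le A :: 'o)"
proof -
  let ?F = "antichain_seqs A le"
  define g :: "'b list \<Rightarrow> 'o" where "g = (\<lambda>xs. wd le (residual le A (set xs)))"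
  let ?m = "wd le A :: 'o"
  have bd: "wle le (residual le A (set xs)) (g xs)" for xs
    unfolding g_def by (rule wle_wd[OF wle_mono[OF assms order_refl]]) (auto simp: residual_def)
  have step: "g (xs @ [x]) < g xs" if "x \<in> residual le A (set xs)" for xs x
    using wleD[OF bd that] wd_le unfolding g_def residual_snoc by (meson le_less_trans)
  have mono: "g (xs @ zs) \<le> g xs" for xs zs
    unfolding g_def by (rule wd_le[OF wle_mono[OF bd[unfolded g_def] order_refl]]) (auto simp: residual_def)
  have dec: "g (xs @ zs) < g xs" if "xs @ zs \<in> ?F" "zs \<noteq> []" for xs zs
  proof -
    obtain z zs' where zs: "zs = z # zs'" using \<open>zs \<noteq> []\<close> by (cases zs) auto
    have "z \<in> residual le A (set xs)"
      using that(1) unfolding zs antichain_seqs_alt residual_def by (auto simp: sorted_wrt_append)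
    then show ?thesis
      using step[of z xs] mono[of "xs @ [z]" zs'] unfolding zs by simp
  qed
  have g0: "g [] = ?m" unfolding g_def by simp
  \<comment> \<open>\<open>is_forest_rank\<close> admits only relations on lists. Attaining every
    value provides one list per ordinal below \<open>?m\<close>, from which \<open>\<gamma>\<close>
    is built.\<close>
  have surj: "\<exists>zs. zs \<noteq> [] \<and> xs @ zs \<in> ?F \<and> g (xs @ zs) = N"
    if "sorted_wrt (incomp le) xs" "set xs \<subseteq> A" "N < g xs" for xs N
    using that
  proof (induction "g xs" arbitrary: xs rule: less_induct)
    case less
    have "wge le (residual le A (set xs)) (g xs)" unfolding g_def by (rule wge_wd)
    then obtain x where x: "x \<in> residual le A (set xs)"
        "wge le (residual le A (set (xs @ [x]))) N"
      unfolding residual_snoc using wgeD less.prems(3) by blast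
    have F: "xs @ [x] \<in> ?F" by (rule antichain_extend[OF less.prems(1,2) x(1)])
    have "N \<le> g (xs @ [x])" using x(2) bd unfolding wge_def by blast
    then consider "N = g (xs @ [x])" | "N < g (xs @ [x])" by fastforce
    then show ?case
    proof cases
      case 1
      then show ?thesis using F by blast
    next
      case 2
      have "\<exists>zs. zs \<noteq> [] \<and> (xs @ [x]) @ zs \<in> ?F \<and> g ((xs @ [x]) @ zs) = N"
        by (rule less.hyps[OF step[OF x(1)] _ _ 2]) (use F in \<open>auto simp: antichain_seqs_alt\<close>)
      then show ?thesis by (metis append.assoc append_is_Nil_conv)
    qed
  qed
  have gm: "g xs < ?m" if "xs \<in> ?F" for xs
    using dec[of "[]" xs] that g0 by (auto simp: antichain_seqs_alt)
  have "\<forall>N. \<exists>zs. N < ?m \<longrightarrow> zs \<in> ?F \<and> g zs = N"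
    using surj[of "[]"] g0 by force
  then obtain s where s: "\<And>N. N < ?m \<Longrightarrow> s N \<in> ?F \<and> g (s N) = N" by metis
  have inj: "inj_on s {..<?m}" by (rule inj_on_inverseI[of _ g]) (use s in auto)
  define \<gamma> where "\<gamma> = dir_image (below ?m) s"
  have \<gamma>: "below ?m =o \<gamma>" "Well_order \<gamma>"
    unfolding \<gamma>_def using inj Well_order_below
    by (auto intro!: dir_image_ordIso Well_order_dir_image)
  have Field: "Field \<gamma> = s ` {..<?m}"
    unfolding \<gamma>_def by (simp add: dir_image_Field)
  have "forest_rank_map ?F \<gamma> (s \<circ> g)"
    unfolding forest_rank_map_def
  proof (intro ballI conjI impI)
    fix xs assume xs: "xs \<in> ?F"
    show "(s \<circ> g) xs \<in> Field \<gamma>" using gm[OF xs] Field by auto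
    fix ys assume ys: "ys \<in> ?F" "\<exists>zs. zs \<noteq> [] \<and> ys = xs @ zs"
    then have less: "g ys < g xs" using dec by blast
    then have "(g ys, g xs) \<in> below ?m" using gm[OF xs] by (simp add: below_def)
    then show "((s \<circ> g) ys, (s \<circ> g) xs) \<in> \<gamma>" unfolding \<gamma>_def dir_image_def by auto
    show "(s \<circ> g) ys \<noteq> (s \<circ> g) xs"
      using less s[OF gm[OF xs]] s[OF gm[OF ys(1)]] by (metis comp_apply less_irrefl)
  qed
  \<comment> \<open>A shorter well-order with a rank map would, read as a labelling, bound the width
    of \<open>A\<close> below its least bound.\<close>
  moreover have "\<gamma> \<le>o \<gamma>'" if "Well_order \<gamma>'" "forest_rank_map ?F \<gamma>' f" for \<gamma>' f
  proof (rule ccontr)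
    assume "\<not> \<gamma> \<le>o \<gamma>'"
    then have "\<gamma>' <o \<gamma>" using not_ordLeq_iff_ordLess[OF that(1) \<gamma>(2)] by blast
    then have "\<gamma>' <o below ?m" using \<gamma>(1) ordLess_ordIso_trans ordIso_symmetric by blast
    then obtain m' where m': "m' < ?m" "\<gamma>' =o below m'" by (rule ordLess_below_imp)
    from m'(2) obtain \<phi> where \<phi>: "bij_betw \<phi> (Field \<gamma>') {..<m'}"
      "\<And>a b. a \<in> Field \<gamma>' \<Longrightarrow> b \<in> Field \<gamma>' \<Longrightarrow> (a, b) \<in> \<gamma>' \<longleftrightarrow> \<phi> a \<le> \<phi> b"
      by (rule ordIso_belowE) blast
    have fF: "f xs \<in> Field \<gamma>'" if "xs \<in> ?F" for xs
      using \<open>forest_rank_map ?F \<gamma>' f\<close> that unfolding forest_rank_map_def by blast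
    have "wle le A m'"
    proof (rule wle_of_decreasing[where g = "\<phi> \<circ> f"])
      show "(\<phi> \<circ> f) xs < m'" if "xs \<in> ?F" for xs
        using bij_betwE[OF \<phi>(1)] fF[OF that] by auto
      fix xs zs assume xs: "xs \<in> ?F" "xs @ zs \<in> ?F" "zs \<noteq> []"
      then have "(f (xs @ zs), f xs) \<in> \<gamma>'" "f (xs @ zs) \<noteq> f xs"
        using \<open>forest_rank_map ?F \<gamma>' f\<close> unfolding forest_rank_map_def by blast+
      then have "\<phi> (f (xs @ zs)) \<le> \<phi> (f xs)" "\<phi> (f (xs @ zs)) \<noteq> \<phi> (f xs)"
        using \<phi>(2) fF xs(1,2) bij_betw_imp_inj_on[OF \<phi>(1)] by (auto dest: inj_onD)
      then show "(\<phi> \<circ> f) (xs @ zs) < (\<phi> \<circ> f) xs" by simp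
    qed
    then have "?m \<le> m'" by (rule wd_le)
    then show False using m'(1) by simp
  qed
  ultimately have rank: "is_forest_rank ?F \<gamma>"
    using \<gamma>(2) unfolding is_forest_rank_def by blast
  then have rank': "is_forest_rank ?F (width A le)"
    unfolding width_def by (rule someI)
  \<comment> \<open>Least ranks are unique up to isomorphism, so the choice made by
    \<open>SOME\<close> does not matter.\<close>
  have "width A le =o \<gamma>"
    using rank rank' unfolding is_forest_rank_def ordIso_iff_ordLeq by blast
  then show ?thesis using \<gamma>(1) ordIso_symmetric ordIso_transitive by blast
qed

lemma width_prod_ordIso_wd:
  fixes rs :: "'b rel list" and M :: "nat \<Rightarrow> 'o::wellorder" and K :: "'k::wellorder"
  assumes n: "length rs = n" and iso: "\<And>i. i < n \<Longrightarrow> rs ! i =o below (M i)"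
    and bd: "wle (fle n) (box n M) K"
  shows "width_prod rs =o below (wd (fle n) (box n M) :: 'k)"
proof -
  have "\<forall>i. \<exists>f. i < n \<longrightarrow> bij_betw f (Field (rs ! i)) {..<M i} \<and>
      (\<forall>a\<in>Field (rs ! i). \<forall>b\<in>Field (rs ! i). (a, b) \<in> rs ! i \<longleftrightarrow> f a \<le> f b)"
    using iso ordIso_belowE by metis
  then obtain f where bij: "\<And>i. i < n \<Longrightarrow> bij_betw (f i) (Field (rs ! i)) {..<M i}"
    and ord: "\<And>i a b. i < n \<Longrightarrow> a \<in> Field (rs ! i) \<Longrightarrow> b \<in> Field (rs ! i) \<Longrightarrow>
        (a, b) \<in> rs ! i \<longleftrightarrow> f i a \<le> f i b"
    by metis
  define g where "g = (\<lambda>i. inv_into (Field (rs ! i)) (f i))"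
  have g: "g i u \<in> Field (rs ! i)" "f i (g i u) = u" if "i < n" "u < M i" for i u
    using bij_betw_inv_into_right[OF bij[OF that(1)]] bij_betwE[OF bij_betw_inv_into[OF bij[OF that(1)]]] that
    unfolding g_def by auto
  \<comment> \<open>\<open>h\<close> and \<open>h'\<close> are not mutually inverse, as points of
    the box are arbitrary from \<open>n\<close> on; it is enough that both preserve and reflect the
    order.\<close>
  define h where "h = (\<lambda>xs i. f i (xs ! i))"
  define h' where "h' = (\<lambda>u. map (\<lambda>i. g i (u i)) [0..<n])"
  have h: "h xs \<in> box n M" if "xs \<in> prod_set rs" for xs
    using that bij_betwE[OF bij] n unfolding h_def box_def prod_set_def by auto
  have h': "h' u \<in> prod_set rs" if "u \<in> box n M" for u
    using that g(1) n unfolding h'_def box_def prod_set_def by auto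
  have le: "prod_le rs xs ys \<longleftrightarrow> fle n (h xs) (h ys)" if "xs \<in> prod_set rs" "ys \<in> prod_set rs" for xs ys
    using that ord n unfolding prod_le_def fle_def h_def prod_set_def by auto
  have hh': "fle n (h (h' u)) (h (h' v)) \<longleftrightarrow> fle n u v" if "u \<in> box n M" "v \<in> box n M" for u v
    using that g(2) unfolding fle_def h_def h'_def box_def by auto
  have iff: "wle (prod_le rs) (prod_set rs) k \<longleftrightarrow> wle (fle n) (box n M) k" for k :: 'k
  proof
    assume "wle (prod_le rs) (prod_set rs) k"
    then show "wle (fle n) (box n M) k"
      by (rule wle_embed[OF _ order_refl, where h = h'])
        (use h' le hh' in \<open>auto simp: incomp_def\<close>)
  next
    assume "wle (fle n) (box n M) k"
    then show "wle (prod_le rs) (prod_set rs) k"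
      by (rule wle_embed[OF _ order_refl, where h = h])
        (use h le in \<open>auto simp: incomp_def\<close>)
  qed
  then have "(wle (prod_le rs) (prod_set rs) :: 'k \<Rightarrow> bool) = wle (fle n) (box n M)"
    by (rule ext)
  then have "(wd (prod_le rs) (prod_set rs) :: 'k) = wd (fle n) (box n M)"
    unfolding wd_def by simp
  then show ?thesis
    using width_ordIso_wd[OF iff[THEN iffD2, OF bd]] unfolding width_prod_def by simp
qed

section \<open>Normal form operations on relations as operations on multisets\<close>

lemma ord_sum_fam_ordIso:
  fixes N :: "nat \<Rightarrow> 'o::wellorder multiset"
  assumes iso: "\<And>j. j < L \<Longrightarrow> r j =o below (N j)"
    and ge: "\<And>i j. i < j \<Longrightarrow> j < L \<Longrightarrow> mset_ge (N i) (N j)"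
  shows "ord_sum_fam L r =o below (\<Sum>j<L. N j)"
proof -
  have "\<forall>j. \<exists>f. j < L \<longrightarrow> bij_betw f (Field (r j)) {..<N j} \<and>
      (\<forall>a\<in>Field (r j). \<forall>b\<in>Field (r j). (a, b) \<in> r j \<longleftrightarrow> f a \<le> f b)"
    using iso ordIso_belowE by metis
  then obtain f where bij: "\<And>j. j < L \<Longrightarrow> bij_betw (f j) (Field (r j)) {..<N j}"
    and ord: "\<And>j a b. j < L \<Longrightarrow> a \<in> Field (r j) \<Longrightarrow> b \<in> Field (r j) \<Longrightarrow>
        (a, b) \<in> r j \<longleftrightarrow> f j a \<le> f j b"
    by metis
  let ?D = "{(j, x). j < L \<and> x \<in> Field (r j)}"
  \<comment> \<open>Element \<open>x\<close> of summand \<open>j\<close> goes behind the sum of the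
    earlier summands. By \<open>less_sum_cases\<close> this is onto: nonincreasing exponents prevent
    absorption.\<close>
  define h where "h = (\<lambda>(j, x). (\<Sum>i<j. N i) + f j x)"
  have refl: "((j, x), (j, x)) \<in> ord_sum_fam L r" if "j < L" "x \<in> Field (r j)" for j x
    using that ord[of j x x] by (simp add: ord_sum_fam_def)
  have "Field (ord_sum_fam L r) \<subseteq> ?D"
    unfolding Field_def ord_sum_fam_def by auto
  moreover have "?D \<subseteq> Field (ord_sum_fam L r)"
    using refl by (auto intro: FieldI1)
  ultimately have Field: "Field (ord_sum_fam L r) = ?D" by blast
  have fN: "f j x < N j" if "j < L" "x \<in> Field (r j)" for j x
    using bij_betwE[OF bij] that by auto
  have lt: "h (j, x) < h (j', x')" if "j < j'" "j' < L" "x \<in> Field (r j)" for j j' x x'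
    unfolding h_def using sum_add_less[of j j' "f j x" N] fN that by simp
  have iff: "((j, x), (j', x')) \<in> ord_sum_fam L r \<longleftrightarrow> h (j, x) \<le> h (j', x')"
    if D: "j < L" "x \<in> Field (r j)" "j' < L" "x' \<in> Field (r j')" for j x j' x'
  proof (cases j j' rule: linorder_cases)
    case less
    then show ?thesis using lt[of j j' x x'] D by (auto simp: ord_sum_fam_def)
  next
    case equal
    then show ?thesis using D ord[of j x x'] by (auto simp: ord_sum_fam_def h_def)
  next
    case greater
    then show ?thesis using lt[of j' j x' x] D by (auto simp: ord_sum_fam_def not_le)
  qed
  show ?thesis
  proof (rule ordIso_belowI)
    show "bij_betw h (Field (ord_sum_fam L r)) {..<\<Sum>j<L. N j}"
      unfolding Field
    proof (intro bij_betw_imageI inj_onI equalityI subsetI)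
      fix p q assume pq: "p \<in> ?D" "q \<in> ?D" "h p = h q"
      obtain j x j' x' where eq: "p = (j, x)" "q = (j', x')" by fastforce
      have "j = j'"
        using pq lt[of j j' x x'] lt[of j' j x' x] unfolding eq by (cases j j' rule: linorder_cases) auto
      moreover have "f j x = f j x'" using pq(3) \<open>j = j'\<close> unfolding eq h_def by simp
      then have "x = x'"
        using pq(1,2) bij_betw_imp_inj_on[OF bij] \<open>j = j'\<close> unfolding eq by (auto dest: inj_onD)
      ultimately show "p = q" unfolding eq by simp
    next
      fix k assume "k \<in> h ` ?D"
      then obtain j x where jx: "j < L" "x \<in> Field (r j)" "k = (\<Sum>i<j. N i) + f j x"
        unfolding h_def by auto
      then show "k \<in> {..<\<Sum>j<L. N j}"
        using sum_add_less[of j L "f j x" N "{#}"] fN by simp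
    next
      fix k assume "k \<in> {..<\<Sum>j<L. N j}"
      then obtain j z where jz: "j < L" "z < N j" "k = (\<Sum>i<j. N i) + z"
        using less_sum_cases[of L N k] ge by auto
      then obtain x where "x \<in> Field (r j)" "f j x = z"
        using bij_betw_imp_surj_on[OF bij[OF jz(1)]] by (metis imageE lessThan_iff)
      then show "k \<in> h ` ?D" using jz by (force simp: h_def)
    qed
  qed (use iff Field in auto)
qed

lemma ord_mult_nat_eq_sum_fam: "ord_mult_nat r c = ord_sum_fam c (\<lambda>_. r)"
  unfolding ord_mult_nat_def ord_sum_fam_def by (rule refl)

lemma ord_mult_nat_ordIso:
  assumes "r =o below {#x :: 'o::wellorder#}"
  shows "ord_mult_nat r c =o below (replicate_mset c x)"
proof -
  have "(\<Sum>k<c. {#x#}) = replicate_mset c x" by (induction c) auto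
  then show ?thesis
    using ord_sum_fam_ordIso[of c "\<lambda>_. r" "\<lambda>_. {#x#}"] assms
    unfolding ord_mult_nat_eq_sum_fam by (simp add: mset_ge_def)
qed

lemma ord_sum2_ordIso:
  fixes M N :: "'o::wellorder multiset"
  assumes r: "r =o below M" and s: "s =o below N" and ge: "mset_ge M N"
  shows "ord_sum2 r s =o below (M + N)"
proof -
  obtain f where f: "bij_betw f (Field r) {..<M}"
    "\<And>a b. a \<in> Field r \<Longrightarrow> b \<in> Field r \<Longrightarrow> (a, b) \<in> r \<longleftrightarrow> f a \<le> f b"
    using r by (rule ordIso_belowE) blast
  obtain g where g: "bij_betw g (Field s) {..<N}"
    "\<And>a b. a \<in> Field s \<Longrightarrow> b \<in> Field s \<Longrightarrow> (a, b) \<in> s \<longleftrightarrow> g a \<le> g b"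
    using s by (rule ordIso_belowE) blast
  have fM: "f a < M" if "a \<in> Field r" for a using bij_betwE[OF f(1)] that by auto
  have gN: "g a < N" if "a \<in> Field s" for a using bij_betwE[OF g(1)] that by auto
  define h where "h = case_sum f (\<lambda>b. M + g b)"
  have rF: "(a, a) \<in> r" if "a \<in> Field r" for a using f(2) that by simp
  have sF: "(a, a) \<in> s" if "a \<in> Field s" for a using g(2) that by simp
  have "Field (ord_sum2 r s) \<subseteq> Inl ` Field r \<union> Inr ` Field s"
    unfolding Field_def ord_sum2_def by auto
  moreover have "Inl a \<in> Field (ord_sum2 r s)" if "a \<in> Field r" for a
    by (rule FieldI1[of _ "Inl a"]) (use rF[OF that] in \<open>simp add: ord_sum2_def\<close>)
  moreover have "Inr a \<in> Field (ord_sum2 r s)" if "a \<in> Field s" for a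
    by (rule FieldI1[of _ "Inr a"]) (use sF[OF that] in \<open>simp add: ord_sum2_def\<close>)
  ultimately have Field: "Field (ord_sum2 r s) = Inl ` Field r \<union> Inr ` Field s" by blast
  have lt: "f a < M + k" if "a \<in> Field r" for a k
    using fM[OF that] by (rule order.strict_trans2) simp
  show ?thesis
  proof (rule ordIso_belowI)
    show "bij_betw h (Field (ord_sum2 r s)) {..<M + N}"
      unfolding Field
    proof (intro bij_betw_imageI inj_onI equalityI subsetI)
      fix p q assume "p \<in> Inl ` Field r \<union> Inr ` Field s" "q \<in> Inl ` Field r \<union> Inr ` Field s" "h p = h q"
      then show "p = q"
        using bij_betw_imp_inj_on[OF f(1)] bij_betw_imp_inj_on[OF g(1)] lt
        by (auto simp: h_def dest: inj_onD) (metis less_irrefl)+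
    next
      fix k assume "k \<in> h ` (Inl ` Field r \<union> Inr ` Field s)"
      then show "k \<in> {..<M + N}" using lt gN by (auto simp: h_def)
    next
      fix k assume "k \<in> {..<M + N}"
      then have "k < M + N" by simp
      with ge show "k \<in> h ` (Inl ` Field r \<union> Inr ` Field s)"
      proof (cases rule: less_add_cases)
        case 1
        then obtain a where "a \<in> Field r" "f a = k"
          using bij_betw_imp_surj_on[OF f(1)] by (metis imageE lessThan_iff)
        then show ?thesis by (force simp: h_def)
      next
        case (2 z)
        then obtain a where "a \<in> Field s" "g a = z"
          using bij_betw_imp_surj_on[OF g(1)] by (metis imageE lessThan_iff)
        then show ?thesis using 2 by (force simp: h_def)
      qed
    qed
  next
    fix p q assume "p \<in> Field (ord_sum2 r s)" "q \<in> Field (ord_sum2 r s)"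
    then show "(p, q) \<in> ord_sum2 r s \<longleftrightarrow> h p \<le> h q"
      using f(2) g(2) lt unfolding Field
      by (auto simp: h_def ord_sum2_def less_imp_le dest: leD)
  qed
qed


lemma Field_omega_exp:
  "Field (omega_exp e) = {\<phi>. (\<forall>x. x \<notin> Field e \<longrightarrow> \<phi> x = 0) \<and> finite {x. \<phi> x \<noteq> 0}}"
proof -
  have "(\<phi>, \<phi>) \<in> omega_exp e" if "\<forall>x. x \<notin> Field e \<longrightarrow> \<phi> x = 0" "finite {x. \<phi> x \<noteq> 0}" for \<phi>
    using that by (simp add: omega_exp_def)
  then show ?thesis
    by (auto simp: omega_exp_def Field_def)
qed

text \<open>A finitely supported function lists the multiplicities of a multiset, and both orders
  compare at the largest difference. Multisets over elements below \<open>x\<close> are exactly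
  those below \<open>{#x#}\<close>.\<close>

lemma omega_exp_ordIso:
  assumes "e =o below (x :: 'o::wellorder)"
  shows "omega_exp e =o below {#x#}"
proof -
  obtain f where f: "bij_betw f (Field e) {..<x}"
    and ord: "\<And>a b. a \<in> Field e \<Longrightarrow> b \<in> Field e \<Longrightarrow> (a, b) \<in> e \<longleftrightarrow> f a \<le> f b"
    using assms by (rule ordIso_belowE) blast
  define g where "g = inv_into (Field e) f"
  have gF: "g u \<in> Field e" and fg: "f (g u) = u" if "u < x" for u
    using bij_betw_inv_into_right[OF f] bij_betwE[OF bij_betw_inv_into[OF f]] that
    unfolding g_def by auto
  have gf: "g (f a) = a" and fx: "f a < x" if "a \<in> Field e" for a
    using bij_betw_inv_into_left[OF f that] bij_betwE[OF f] that unfolding g_def by auto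
  let ?D = "{\<phi> :: 'a \<Rightarrow> nat. (\<forall>x. x \<notin> Field e \<longrightarrow> \<phi> x = 0) \<and> finite {x. \<phi> x \<noteq> 0}}"
  define T where "T = (\<lambda>\<phi> :: 'a \<Rightarrow> nat. Abs_multiset (\<lambda>u. if u < x then \<phi> (g u) else 0))"
  have count: "count (T \<phi>) u = (if u < x then \<phi> (g u) else 0)" if "\<phi> \<in> ?D" for \<phi> u
  proof -
    have "{u. 0 < (if u < x then \<phi> (g u) else 0)} \<subseteq> f ` {a. \<phi> a \<noteq> 0}"
      using fg by (force split: if_splits)
    then have "finite {u. 0 < (if u < x then \<phi> (g u) else 0)}"
      by (rule finite_subset) (use that in auto)
    then show ?thesis unfolding T_def by (simp add: count_Abs_multiset)
  qed
  have count_f: "count (T \<phi>) (f a) = \<phi> a" if "\<phi> \<in> ?D" "a \<in> Field e" for \<phi> a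
    using count[OF that(1)] gf fx that(2) by simp
  have inj: "\<phi> = \<psi>" if "\<phi> \<in> ?D" "\<psi> \<in> ?D" "T \<phi> = T \<psi>" for \<phi> \<psi>
  proof
    fix a show "\<phi> a = \<psi> a"
      using count_f[OF that(1)] count_f[OF that(2)] that by (cases "a \<in> Field e") auto
  qed
  have less: "(\<exists>a\<in>Field e. \<phi> a < \<psi> a \<and> (\<forall>b\<in>Field e. (a, b) \<in> e \<and> b \<noteq> a \<longrightarrow> \<phi> b = \<psi> b)) \<longleftrightarrow> T \<phi> < T \<psi>"
    if \<phi>: "\<phi> \<in> ?D" and \<psi>: "\<psi> \<in> ?D" for \<phi> \<psi>
    unfolding less_multiset_iff_max_diff
  proof
    assume "\<exists>a\<in>Field e. \<phi> a < \<psi> a \<and> (\<forall>b\<in>Field e. (a, b) \<in> e \<and> b \<noteq> a \<longrightarrow> \<phi> b = \<psi> b)"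
    then obtain a where a: "a \<in> Field e" "\<phi> a < \<psi> a"
      "\<And>b. b \<in> Field e \<Longrightarrow> (a, b) \<in> e \<Longrightarrow> b \<noteq> a \<Longrightarrow> \<phi> b = \<psi> b" by blast
    have "count (T \<phi>) v = count (T \<psi>) v" if "v > f a" for v
    proof (cases "v < x")
      case True
      then have "(a, g v) \<in> e" "g v \<noteq> a"
        using ord[OF a(1) gF[OF True]] fg[OF True] that by auto
      then show ?thesis using a(3)[OF gF[OF True]] count \<phi> \<psi> by simp
    qed (simp add: count[OF \<phi>] count[OF \<psi>])
    moreover have "count (T \<phi>) (f a) < count (T \<psi>) (f a)"
      using a(1,2) count_f \<phi> \<psi> by simp
    ultimately show "\<exists>u. count (T \<phi>) u < count (T \<psi>) u \<and> (\<forall>v>u. count (T \<phi>) v = count (T \<psi>) v)"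
      by blast
  next
    assume "\<exists>u. count (T \<phi>) u < count (T \<psi>) u \<and> (\<forall>v>u. count (T \<phi>) v = count (T \<psi>) v)"
    then obtain u where u: "count (T \<phi>) u < count (T \<psi>) u" "\<And>v. v > u \<Longrightarrow> count (T \<phi>) v = count (T \<psi>) v"
      by blast
    then have "u < x" using count[OF \<psi>] by (metis less_nat_zero_code)
    have "\<phi> (g u) < \<psi> (g u)" using u(1) \<open>u < x\<close> count \<phi> \<psi> by simp
    moreover have "\<phi> b = \<psi> b" if "b \<in> Field e" "(g u, b) \<in> e" "b \<noteq> g u" for b
    proof -
      have "u \<le> f b" using ord[OF gF[OF \<open>u < x\<close>] that(1)] that(2) fg \<open>u < x\<close> by simp
      moreover have "f b \<noteq> u" using gf that by auto
      ultimately show ?thesis using u(2)[of "f b"] count_f \<phi> \<psi> that(1) by simp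
    qed
    ultimately show "\<exists>a\<in>Field e. \<phi> a < \<psi> a \<and> (\<forall>b\<in>Field e. (a, b) \<in> e \<and> b \<noteq> a \<longrightarrow> \<phi> b = \<psi> b)"
      using gF[OF \<open>u < x\<close>] by blast
  qed
  show ?thesis
  proof (rule ordIso_belowI)
    show "bij_betw T (Field (omega_exp e)) {..<{#x#}}"
      unfolding Field_omega_exp
    proof (intro bij_betw_imageI inj_onI equalityI subsetI)
      fix M assume "M \<in> T ` ?D"
      then obtain \<phi> where \<phi>: "\<phi> \<in> ?D" "M = T \<phi>" by blast
      have "u < x" if "u \<in># M" for u
        using count[OF \<phi>(1), of u] that unfolding \<phi>(2) by (metis count_eq_zero_iff)
      then show "M \<in> {..<{#x#}}" by simp
    next
      fix M assume "M \<in> {..<{#x#}}"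
      then have M: "u < x" if "u \<in># M" for u using that by simp
      define \<phi> where "\<phi> = (\<lambda>a. if a \<in> Field e then count M (f a) else 0)"
      have "{a. \<phi> a \<noteq> 0} \<subseteq> g ` set_mset M"
        using gf by (force simp: \<phi>_def split: if_splits)
      then have "finite {a. \<phi> a \<noteq> 0}" by (rule finite_subset) simp
      then have D: "\<phi> \<in> ?D" by (simp add: \<phi>_def)
      have "count (T \<phi>) u = count M u" for u
      proof (cases "u < x")
        case True
        then show ?thesis using count[OF D, of u] gF fg by (simp add: \<phi>_def)
      next
        case False
        then have "count M u = 0" using M by (meson count_inI)
        then show ?thesis using count[OF D, of u] False by simp
      qed
      then have "M = T \<phi>" by (simp add: multiset_eq_iff)
      then show "M \<in> T ` ?D" using D by blast
    qed (rule inj)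
  next
    fix \<phi> \<psi> assume "\<phi> \<in> Field (omega_exp e)" "\<psi> \<in> Field (omega_exp e)"
    then have D: "\<phi> \<in> ?D" "\<psi> \<in> ?D" unfolding Field_omega_exp by auto
    then have "(\<phi>, \<psi>) \<in> omega_exp e \<longleftrightarrow> \<phi> = \<psi> \<or> T \<phi> < T \<psi>"
      unfolding omega_exp_def less[OF D, symmetric] by simp
    then show "(\<phi>, \<psi>) \<in> omega_exp e \<longleftrightarrow> T \<phi> \<le> T \<psi>"
      using inj[OF D] by (auto simp: order.order_iff_strict)
  qed
qed

section \<open>Natural sums through a common list of exponents\<close>

lemma cnf_ord_ordIso:
  fixes x :: "nat \<Rightarrow> 'o::wellorder"
  assumes "\<And>j. j < L \<Longrightarrow> e j =o below (x j)"
    and "\<And>i j. i < j \<Longrightarrow> j < L \<Longrightarrow> x j \<le> x i"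
  shows "cnf_ord L e c =o below (\<Sum>j<L. replicate_mset (c j) (x j))"
  unfolding cnf_ord_def
  by (rule ord_sum_fam_ordIso)
    (use assms in \<open>auto intro: ord_mult_nat_ordIso omega_exp_ordIso simp: mset_ge_def\<close>)

lemma sum_replicate_count:
  fixes x :: "nat \<Rightarrow> 'o"
  assumes "inj_on x {..<L}" "set_mset M \<subseteq> x ` {..<L}"
  shows "(\<Sum>j<L. replicate_mset (count M (x j)) (x j)) = M"
proof -
  have "(\<Sum>j<L. replicate_mset (count M (x j)) (x j)) =
      (\<Sum>u\<in>x ` {..<L}. replicate_mset (count M u) u)"
    by (rule sum.reindex_cong[OF assms(1) refl refl, symmetric])
  also have "\<dots> = M"
  proof (rule multiset_eqI)
    fix v
    show "count (\<Sum>u\<in>x ` {..<L}. replicate_mset (count M u) u) v = count M v"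
      using assms(2) by (auto simp: count_sum not_in_iff)
  qed
  finally show ?thesis .
qed

text \<open>If \<open>below m\<close> were shorter, \<open>f\<close> followed by the isomorphism
  would map the ordinals below \<open>x\<close> strictly increasingly into some
  \<open>x' < x\<close>; such a map never goes below its argument, which fails at
  \<open>x'\<close>.\<close>

lemma below_ordLeq_of_strict_mono:
  fixes x :: "'o::wellorder" and m :: "'k::wellorder"
  assumes "\<And>u. u < x \<Longrightarrow> f u < m" "\<And>u v. u < v \<Longrightarrow> v < x \<Longrightarrow> f u < f v"
  shows "below x \<le>o below m"
proof (rule ccontr)
  assume "\<not> below x \<le>o below m"
  then have "below m <o below x"
    using not_ordLeq_iff_ordLess[OF Well_order_below Well_order_below] by blast
  then obtain x' where x': "x' < x" "below m =o below x'" by (rule ordLess_below_imp)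
  from x'(2) obtain g where g: "bij_betw g (Field (below m)) {..<x'}"
    "\<And>a b. a \<in> Field (below m) \<Longrightarrow> b \<in> Field (below m) \<Longrightarrow> (a, b) \<in> below m \<longleftrightarrow> g a \<le> g b"
    by (rule ordIso_belowE) blast
  have mono: "g (f u) < g (f v)" if uv: "u < v" "v < x" for u v
  proof -
    have "f u < f v" "f u < m" "f v < m" using assms uv by auto
    then have "(f v, f u) \<notin> below m" by (simp add: below_def)
    then show ?thesis using g(2)[of "f v" "f u"] \<open>f u < m\<close> \<open>f v < m\<close> by simp
  qed
  have "u \<le> g (f u)" if "u < x" for u
    using that
  proof (induction u rule: less_induct)
    case (less u)
    show ?case
    proof (rule ccontr)
      assume "\<not> u \<le> g (f u)"
      then have lt: "g (f u) < u" by simp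
      then have "g (f u) \<le> g (f (g (f u)))" using less by auto
      then show False using mono[OF lt less.prems] by simp
    qed
  qed
  then have "x' \<le> g (f x')" using x'(1) by blast
  moreover have "g (f x') < x'" using bij_betwE[OF g(1)] assms(1)[OF x'(1)] by auto
  ultimately show False by simp
qed

text \<open>The common exponents are those occurring in \<open>W\<close>, in decreasing order, and
  the coefficients are multiplicities.\<close>

lemma is_hessenberg_combI:
  fixes W :: "'o::wellorder multiset" and \<gamma> :: "'x rel"
  assumes fin: "finite T" and \<gamma>: "\<gamma> =o below W" and r: "\<And>t. t \<in> T \<Longrightarrow> r t =o below (w t)"
    and W: "W = (\<Sum>t\<in>T. repeat_mset (m t) (w t))" and pos: "\<And>t. t \<in> T \<Longrightarrow> m t > 0"
  shows "is_hessenberg_comb \<gamma> T r m"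
proof -
  define us where "us = rev (sorted_list_of_set (set_mset W))"
  define L where "L = length us"
  define x where "x = (\<lambda>j. us ! j)"
  have set_us: "set us = set_mset W" and "distinct us"
    unfolding us_def by auto
  then have x: "inj_on x {..<L}" "x ` {..<L} = set_mset W"
    unfolding x_def L_def by (auto simp: inj_on_def nth_eq_iff_index_eq set_conv_nth)
  have dec: "x j < x i" if "i < j" "j < L" for i j
  proof -
    have "sorted_wrt (<) (rev us)" unfolding us_def by simp
    then have "sorted_wrt (\<lambda>a b. b < a) us" by (simp add: sorted_wrt_rev)
    then show ?thesis
      using that unfolding sorted_wrt_iff_nth_less x_def L_def by blast
  qed
  \<comment> \<open>The exponents must be relations on the carrier type of \<open>\<gamma>\<close>.
    They fit because an exponent is at most its power of omega, which is at most
    \<open>W\<close>.\<close>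
  have "\<exists>e :: 'x rel. e =o below (x j)" if j: "j < L" for j
  proof -
    have "below (x j) \<le>o below {#x j#}"
      by (rule below_ordLeq_of_strict_mono[where f = "\<lambda>u. {#u#}"]) simp_all
    also have "x j \<in># W" using x(2) j by blast
    then have "below {#x j#} \<le>o below W"
      by (intro below_ordLeq) (simp add: subset_eq_imp_le_multiset)
    also have "below W =o \<gamma>" using \<gamma> by (rule ordIso_symmetric)
    finally show ?thesis using internalize_ordLeq[of "below (x j)" \<gamma>] ordIso_symmetric by blast
  qed
  then obtain e :: "nat \<Rightarrow> 'x rel" where e: "\<And>j. j < L \<Longrightarrow> e j =o below (x j)" by metis
  \<comment> \<open>Positive multipliers ensure that no exponent of a summand is missing from
    \<open>W\<close>.\<close>
  have sub: "set_mset (w t) \<subseteq> set_mset W" if "t \<in> T" for t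
  proof
    fix u assume "u \<in># w t"
    then have "0 < count (repeat_mset (m t) (w t)) u" using pos[OF that] by simp
    also have "\<dots> \<le> count W u"
      unfolding W count_sum using fin that by (intro member_le_sum) auto
    finally show "u \<in># W" by simp
  qed
  have cnf: "below M =o cnf_ord L e (\<lambda>j. count M (x j))" if "set_mset M \<subseteq> set_mset W" for M
    using cnf_ord_ordIso[of L e x "\<lambda>j. count M (x j)"] e dec sum_replicate_count[OF x(1), of M] that x(2)
    by (auto intro: ordIso_symmetric less_imp_le)
  show ?thesis
    unfolding is_hessenberg_comb_def
  proof (intro conjI fin exI[of _ L] exI[of _ e] exI[of _ "\<lambda>t j. count (w t) (x j)"] allI impI ballI)
    fix j assume "j < L"
    then show "Well_order (e j)" using e unfolding ordIso_def by blast
  next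
    fix j assume j: "Suc j < L"
    have "e (Suc j) <o below (x j)"
      using ordIso_ordLess_trans[OF e[OF j] below_ordLess[OF dec[of j "Suc j"]]] j by simp
    then show "e (Suc j) <o e j"
      using ordLess_ordIso_trans ordIso_symmetric e[of j] j by (meson Suc_lessD)
  next
    fix t assume t: "t \<in> T"
    show "r t =o cnf_ord L e (\<lambda>j. count (w t) (x j))"
      using ordIso_transitive[OF r[OF t] cnf[OF sub[OF t]]] .
  next
    have "(\<lambda>j. count W (x j)) = (\<lambda>j. \<Sum>t\<in>T. m t * count (w t) (x j))"
      unfolding W by (simp add: count_sum)
    then show "\<gamma> =o cnf_ord L e (\<lambda>j. \<Sum>t\<in>T. m t * count (w t) (x j))"
      using ordIso_transitive[OF \<gamma> cnf[OF order_refl]] by simp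
  qed
qed

section \<open>Products of ordinals\<close>

text \<open>Exponents live in \<open>'a list suc\<close>: lists form an infinite type into which
  products of \<open>n\<close> well-orders on \<open>'a\<close> inject, as
  \<open>wle_box_exists\<close> requires.\<close>

lemma ex_below_suc:
  fixes r :: "'a rel"
  assumes "Well_order r"
  obtains x :: "'a list suc" where "r =o below x"
proof -
  have "|UNIV :: 'a set| \<le>o |UNIV :: 'a list set|"
    by (rule card_of_ordLeqI[of "\<lambda>x. [x]"]) (auto simp: inj_on_def)
  then have "|UNIV :: 'a set| <o |UNIV :: 'a list suc set|"
    using card_of_UNIV_suc ordLeq_ordLess_trans by blast
  with assms show ?thesis using that by (rule ex_below)
qed

text \<open>An ordinal \<open>x\<close> is at most omega^x, and the ordinals up to omega^x are given
  by multisets.\<close>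

lemma ex_below_suc_mset:
  fixes r :: "'a rel"
  assumes "Well_order r"
  obtains M :: "'a list suc multiset" where "r =o below M"
proof -
  obtain x :: "'a list suc" where x: "r =o below x"
    using assms by (rule ex_below_suc)
  have "below x \<le>o below {#x#}"
    by (rule below_ordLeq_of_strict_mono[where f = "\<lambda>u. {#u#}"]) simp_all
  then have "r \<le>o below {#x#}" using x ordIso_ordLeq_trans by blast
  then consider "r <o below {#x#}" | "r =o below {#x#}"
    using ordLeq_iff_ordLess_or_ordIso by blast
  then show ?thesis using that ordLess_below_imp by cases blast+
qed

lemma wle_box_of_orders:
  fixes \<alpha> :: "nat \<Rightarrow> 'a rel" and M :: "nat \<Rightarrow> 'a list suc multiset"
  assumes "\<And>i. i < n \<Longrightarrow> \<alpha> i =o below (M i)"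
  shows "\<exists>K :: 'a list suc multiset. wle (fle n) (box n M) K"
proof (rule wle_box_exists)
  show "infinite (UNIV :: 'a list set)" by (rule infinite_UNIV_listI)
  have "\<forall>i. \<exists>g :: _ \<Rightarrow> 'a. i < n \<longrightarrow> inj_on g {..<M i}"
    using assms ordIso_belowE bij_betw_inv_into bij_betw_imp_inj_on by metis
  then obtain g :: "nat \<Rightarrow> 'a list suc multiset \<Rightarrow> 'a" where g: "\<And>i. i < n \<Longrightarrow> inj_on (g i) {..<M i}"
    by metis
  show "|\<Pi>\<^sub>E i\<in>{..<n}. {..<M i}| \<le>o |UNIV :: 'a list set|"
  proof (rule card_of_ordLeqI)
    show "inj_on (\<lambda>f. map (\<lambda>i. g i (f i)) [0..<n]) (\<Pi>\<^sub>E i\<in>{..<n}. {..<M i})"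
    proof (rule inj_onI)
      fix f f' assume f: "f \<in> (\<Pi>\<^sub>E i\<in>{..<n}. {..<M i})" "f' \<in> (\<Pi>\<^sub>E i\<in>{..<n}. {..<M i})"
        and eq: "map (\<lambda>i. g i (f i)) [0..<n] = map (\<lambda>i. g i (f' i)) [0..<n]"
      have "f i = f' i" if "i < n" for i
      proof (rule inj_onD[OF g[OF that]])
        show "g i (f i) = g i (f' i)" using eq that by (simp add: map_eq_conv)
      qed (use f that in auto)
      then show "f = f'" using f by (intro PiE_ext[OF f]) auto
    qed
  qed simp
qed

text \<open>If \<open>y 0\<close> were the least element, all exponents would be least, each block
  omega^0 would be a single point, and finitely many such blocks would be finite.\<close>

lemma infinite_imp_limit:
  fixes y :: "nat \<Rightarrow> 'o::wellorder"
  assumes iso: "r =o below (\<Sum>j<L. {#y j#})" and inf: "infinite (Field r)"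
    and dec: "\<And>j k. j \<le> k \<Longrightarrow> k < L \<Longrightarrow> y k \<le> y j"
  shows "\<exists>b. b < y 0"
proof (rule ccontr)
  assume "\<not> (\<exists>b. b < y 0)"
  then have least: "y 0 \<le> b" for b by (meson not_le)
  have "{..<\<Sum>j<L. {#y j#}} \<subseteq> (\<lambda>j. \<Sum>i<j. {#y i#}) ` {..<L}"
  proof
    fix k assume "k \<in> {..<\<Sum>j<L. {#y j#}}"
    then have "\<exists>j<L. \<exists>z<{#y j#}. k = (\<Sum>i<j. {#y i#}) + z"
      by (intro less_sum_cases) (use dec in \<open>auto simp: mset_ge_def\<close>)
    then obtain j z where jz: "j < L" "z < {#y j#}" "k = (\<Sum>i<j. {#y i#}) + z" by blast
    have "u \<notin># z" for u
    proof
      assume "u \<in># z"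
      then have "u < y j" using jz(2) by simp
      also have "y j \<le> y 0" using dec jz(1) by simp
      finally show False using least[of u] by simp
    qed
    then have "z = {#}" by (simp add: multiset_nonemptyE[of z] multiset_eqI not_in_iff)
    then show "k \<in> (\<lambda>j. \<Sum>i<j. {#y i#}) ` {..<L}" using jz by simp
  qed
  then have "finite {..<\<Sum>j<L. {#y j#}}" by (rule finite_subset) simp
  moreover obtain f where "bij_betw f (Field r) {..<\<Sum>j<L. {#y j#}}"
    using iso by (rule ordIso_belowE)
  ultimately show False using inf bij_betw_finite by blast
qed

text \<open>Unfolds coefficients: \<open>\<kappa> k\<close> is the term to which single block number
  \<open>k\<close> belongs, term \<open>j\<close> receiving \<open>a j\<close> consecutive
  blocks.\<close>

lemma expand_multiplicities:
  fixes a :: "nat \<Rightarrow> nat"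
  shows "\<exists>(\<kappa> :: nat \<Rightarrow> nat) L. (\<forall>k<L. \<kappa> k < l) \<and> (\<forall>j k. j \<le> k \<longrightarrow> k < L \<longrightarrow> \<kappa> j \<le> \<kappa> k) \<and>
    (\<forall>j<l. card {k. k < L \<and> \<kappa> k = j} = a j)"
proof (induction l)
  case 0
  show ?case by (rule exI[of _ "\<lambda>k. 0"], rule exI[of _ 0]) simp
next
  case (Suc l)
  from Suc.IH obtain \<kappa> :: "nat \<Rightarrow> nat" where "\<exists>L. (\<forall>k<L. \<kappa> k < l) \<and>
    (\<forall>j k. j \<le> k \<longrightarrow> k < L \<longrightarrow> \<kappa> j \<le> \<kappa> k) \<and> (\<forall>j<l. card {k. k < L \<and> \<kappa> k = j} = a j)"
    by (rule exE)
  then obtain L where *: "(\<forall>k<L. \<kappa> k < l) \<and> (\<forall>j k. j \<le> k \<longrightarrow> k < L \<longrightarrow> \<kappa> j \<le> \<kappa> k) \<and>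
    (\<forall>j<l. card {k. k < L \<and> \<kappa> k = j} = a j)"
    by (rule exE)
  have 1: "\<And>k. k < L \<Longrightarrow> \<kappa> k < l" and 2: "\<And>j k. j \<le> k \<Longrightarrow> k < L \<Longrightarrow> \<kappa> j \<le> \<kappa> k"
    and 3: "\<And>j. j < l \<Longrightarrow> card {k. k < L \<and> \<kappa> k = j} = a j"
    using * by blast+
  define \<kappa>' where "\<kappa>' = (\<lambda>k. if k < L then \<kappa> k else l)"
  show ?case
  proof (intro exI[of _ \<kappa>'] exI[of _ "L + a l"] conjI allI impI)
    show "\<kappa>' k < Suc l" if "k < L + a l" for k
      using 1[of k] by (auto simp: \<kappa>'_def)
    show "\<kappa>' j \<le> \<kappa>' k" if "j \<le> k" "k < L + a l" for j k
      using 2[of j k] 1[of j] that by (auto simp: \<kappa>'_def less_imp_le)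
    fix j assume "j < Suc l"
    show "card {k. k < L + a l \<and> \<kappa>' k = j} = a j"
    proof (cases "j = l")
      case True
      have "\<kappa>' k = l \<longleftrightarrow> L \<le> k" for k
        using 1[of k] by (auto simp: \<kappa>'_def)
      then have "k < L + a l \<and> \<kappa>' k = j \<longleftrightarrow> k \<in> {L..<L + a l}" for k
        unfolding True by (metis atLeastLessThan_iff)
      then have "{k. k < L + a l \<and> \<kappa>' k = j} = {L..<L + a l}" by blast
      then show ?thesis using True by simp
    next
      case False
      then have "k < L + a l \<and> \<kappa>' k = j \<longleftrightarrow> k < L \<and> \<kappa> k = j" for k
        unfolding \<kappa>'_def by (cases "k < L") simp_all
      then have "{k. k < L + a l \<and> \<kappa>' k = j} = {k. k < L \<and> \<kappa> k = j}" by blast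
      then show ?thesis using 3 False \<open>j < Suc l\<close> by simp
    qed
  qed
qed

section \<open>Counting frontier cells by normal form terms\<close>

lemma sum_const_mset: "finite A \<Longrightarrow> (\<Sum>x\<in>A. M) = repeat_mset (card A) M"
  by (induction A rule: finite_induct) auto

lemma repeat_mset_sum: "repeat_mset k (\<Sum>x\<in>A. f x) = (\<Sum>x\<in>A. repeat_mset k (f x))"
  by (rule multiset_eqI) (simp add: count_sum sum_distrib_left)

lemma box_cong: "(\<And>i. i < n \<Longrightarrow> M i = M' i) \<Longrightarrow> box n M = box n M'"
  unfolding box_def by simp

text \<open>Supplies the hypothesis of \<open>wd_box\<close> when every coordinate is in
  \<open>J\<close>.\<close>

lemma ex_min_coordinate:
  assumes "n \<ge> 1"
  shows "\<exists>i\<in>{..<n}. \<forall>j<n. (p :: nat \<Rightarrow> nat) i \<le> p j"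
  using ex_has_least_nat[of "\<lambda>i. i < n" 0 p] assms by auto

text \<open>The number of frontier cells whose sides come from the terms \<open>t\<close>: all
  choices of a copy of each term, minus those in which no coordinate uses the very first
  block.\<close>

definition grid_coeff :: "nat \<Rightarrow> (nat \<Rightarrow> nat \<Rightarrow> nat) \<Rightarrow> (nat \<Rightarrow> nat) \<Rightarrow> nat" where
  "grid_coeff n a t = ((\<Prod>i\<in>{i. i < n \<and> t i = 0}. a i 0) - (\<Prod>i\<in>{i. i < n \<and> t i = 0}. a i 0 - 1))
    * (\<Prod>i\<in>{i. i < n \<and> t i > 0}. a i (t i))"

lemma grid_coeff_cong:
  assumes "\<And>i. i < n \<Longrightarrow> t i = t' i"
  shows "grid_coeff n a t = grid_coeff n a t'"
proof -
  have "{i. i < n \<and> t i = 0} = {i. i < n \<and> t' i = 0}" "{i. i < n \<and> t i > 0} = {i. i < n \<and> t' i > 0}"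
    using assms by auto
  moreover have "(\<Prod>i\<in>{i. i < n \<and> t' i > 0}. a i (t i)) = (\<Prod>i\<in>{i. i < n \<and> t' i > 0}. a i (t' i))"
    using assms by (intro prod.cong) auto
  ultimately show ?thesis unfolding grid_coeff_def by presburger
qed

lemma prod_diff_pos:
  fixes a :: "'i \<Rightarrow> nat"
  assumes "finite I" "I \<noteq> {}" "\<And>i. i \<in> I \<Longrightarrow> a i > 0"
  shows "0 < (\<Prod>i\<in>I. a i) - (\<Prod>i\<in>I. a i - 1)"
proof -
  obtain i where "i \<in> I" using assms(2) by blast
  then have "(\<Prod>i\<in>I. a i - 1) < (\<Prod>i\<in>I. a i)"
    by (rule prod_mono_strict) (use assms in \<open>auto simp: \<open>i \<in> I\<close>\<close>)
  then show ?thesis by simp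
qed

text \<open>Terms with coefficients become runs of single blocks, \<open>wd_box\<close> applies with
  all coordinates in \<open>J\<close>, and the frontier cells are grouped by the terms their sides
  come from.\<close>

lemma wd_product:
  fixes x :: "nat \<Rightarrow> nat \<Rightarrow> 'o::wellorder"
  assumes n: "n \<ge> 1"
    and dec: "\<And>i j k. i < n \<Longrightarrow> j \<le> k \<Longrightarrow> k < l i \<Longrightarrow> x i k \<le> x i j"
    and pos: "\<And>i j. i < n \<Longrightarrow> j < l i \<Longrightarrow> a i j > 0"
    and iso: "\<And>i. i < n \<Longrightarrow> \<alpha> i =o below (M i)"
    and inf: "\<And>i. i < n \<Longrightarrow> infinite (Field (\<alpha> i))"
    and M: "\<And>i. i < n \<Longrightarrow> M i = (\<Sum>j<l i. replicate_mset (a i j) (x i j))"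
    and bd: "wle (fle n) (box n M) (K :: 'o multiset)"
  shows "wd (fle n) (box n M) =
    (\<Sum>t\<in>{t\<in>\<Pi>\<^sub>E i\<in>{..<n}. {..<l i}. \<exists>i<n. t i = 0}.
      repeat_mset (grid_coeff n a t) (wd (fle n) (cube n (\<lambda>i. x i (t i))) :: 'o multiset))"
proof -
  define P where "P = (\<lambda>i (\<kappa> :: nat \<Rightarrow> nat) L. (\<forall>k<L. \<kappa> k < l i) \<and>
    (\<forall>j k. j \<le> k \<longrightarrow> k < L \<longrightarrow> \<kappa> j \<le> \<kappa> k) \<and> (\<forall>j<l i. card {k. k < L \<and> \<kappa> k = j} = a i j))"
  have "\<forall>i. \<exists>\<kappa> L. P i \<kappa> L"
    unfolding P_def by (intro allI expand_multiplicities)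
  from choice[OF this] obtain \<kappa> where "\<forall>i. \<exists>L. P i (\<kappa> i) L" by (rule exE)
  from choice[OF this] obtain L where P: "\<forall>i. P i (\<kappa> i) (L i)" by (rule exE)
  have \<kappa>: "\<And>i k. k < L i \<Longrightarrow> \<kappa> i k < l i"
    and mono: "\<And>i j k. j \<le> k \<Longrightarrow> k < L i \<Longrightarrow> \<kappa> i j \<le> \<kappa> i k"
    and card: "\<And>i j. j < l i \<Longrightarrow> card {k. k < L i \<and> \<kappa> i k = j} = a i j"
    using P unfolding P_def by blast+
  \<comment> \<open>Term 0 has a positive coefficient, so the first block belongs to it.\<close>
  have \<kappa>0: "0 < L i" "\<kappa> i 0 = 0" if "i < n" "0 < l i" for i
  proof -
    have "card {k. k < L i \<and> \<kappa> i k = 0} > 0" using card pos that by simp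
    then have "{k. k < L i \<and> \<kappa> i k = 0} \<noteq> {}" by (metis card.empty less_irrefl)
    then obtain k where k: "k < L i" "\<kappa> i k = 0" by blast
    then show "0 < L i" by simp
    show "\<kappa> i 0 = 0" using mono[of 0 k i] k by simp
  qed
  define y where "y = (\<lambda>i k. x i (\<kappa> i k))"
  have My: "M i = (\<Sum>k<L i. {#y i k#})" if "i < n" for i
  proof -
    have "(\<Sum>k<L i. {#y i k#}) = (\<Sum>j<l i. \<Sum>k\<in>{k\<in>{..<L i}. \<kappa> i k = j}. {#y i k#})"
      by (rule sum.group[symmetric]) (use \<kappa> in auto)
    also have "\<dots> = (\<Sum>j<l i. replicate_mset (a i j) (x i j))"
    proof (rule sum.cong[OF refl])
      fix j assume "j \<in> {..<l i}"
      have "(\<Sum>k\<in>{k\<in>{..<L i}. \<kappa> i k = j}. {#y i k#}) = (\<Sum>k\<in>{k\<in>{..<L i}. \<kappa> i k = j}. {#x i j#})"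
        by (rule sum.cong) (auto simp: y_def)
      also have "\<dots> = repeat_mset (a i j) {#x i j#}"
        using card[of j i] \<open>j \<in> {..<l i}\<close> by (subst sum_const_mset) auto
      finally show "(\<Sum>k\<in>{k\<in>{..<L i}. \<kappa> i k = j}. {#y i k#}) = replicate_mset (a i j) (x i j)"
        by simp
    qed
    finally show ?thesis using M[OF that] by simp
  qed
  have ydec: "y i k \<le> y i j" if "i < n" "j \<le> k" "k < L i" for i j k
    unfolding y_def using that mono \<kappa> by (intro dec) auto
  interpret staircase n y L "{..<n}"
  proof
    show "\<exists>b. b < y i 0" if "i \<in> {..<n}" for i
      by (rule infinite_imp_limit[of "\<alpha> i" y "L i" for y]) (use that iso My inf ydec in auto)
    show "\<exists>K :: 'o multiset. wle (fle n) (box n (\<lambda>i. \<Sum>j<L i. {#y i j#})) K"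
      using bd box_cong[of n M "\<lambda>i. \<Sum>j<L i. {#y i j#}"] My by auto
  qed (use ydec in auto)
  let ?T = "{t\<in>\<Pi>\<^sub>E i\<in>{..<n}. {..<l i}. \<exists>i<n. t i = 0}"
  define v :: "(nat \<Rightarrow> nat) \<Rightarrow> 'o multiset" where "v = (\<lambda>t. wd (fle n) (cube n (\<lambda>i. x i (t i))))"
  define key where "key = (\<lambda>p. \<lambda>i\<in>{..<n}. \<kappa> i (p i))"
  have cell: "cell_wd p = v (key p)" for p
    unfolding cell_wd_def v_def key_def
    by (rule arg_cong[where f = "wd (fle n)"], rule box_cong) (simp add: y_def)
  have finT: "finite ?T" by (simp add: finite_PiE)
  have key: "key ` frontier \<subseteq> ?T"
  proof (intro image_subsetI CollectI conjI)
    fix p assume p: "p \<in> frontier"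
    then show "key p \<in> (\<Pi>\<^sub>E i\<in>{..<n}. {..<l i})"
      using \<kappa> unfolding frontier_def key_def by auto
    obtain i where i: "i < n" "p i = 0" using p unfolding frontier_def by blast
    moreover have "p i < L i" using p i(1) unfolding frontier_def by (auto simp: PiE_iff)
    ultimately have "\<kappa> i 0 = 0" using \<kappa>0 \<kappa>[of "p i" i] by simp
    then have "key p i = 0" using i unfolding key_def by simp
    then show "\<exists>i<n. key p i = 0" using i(1) by blast
  qed
  have fiber: "card {p\<in>frontier. key p = t} = grid_coeff n a t" if t: "t \<in> ?T" for t
  proof -
    define fib where "fib = (\<lambda>i. {k. k < L i \<and> \<kappa> i k = t i})"
    have tl: "t i < l i" if "i < n" for i using t that by auto
    have fin: "finite (fib i)" for i unfolding fib_def by simp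
    \<comment> \<open>The positions with key \<open>t\<close> form a product of fibres; those off
      the frontier avoid index 0 in every fibre.\<close>
    have "{p\<in>frontier. key p = t} = (\<Pi>\<^sub>E i\<in>{..<n}. fib i) - (\<Pi>\<^sub>E i\<in>{..<n}. fib i - {0})"
    proof (intro equalityI subsetI)
      fix p assume p: "p \<in> {p\<in>frontier. key p = t}"
      then have "\<kappa> i (p i) = t i" if "i < n" for i
        using that unfolding key_def by auto
      then show "p \<in> (\<Pi>\<^sub>E i\<in>{..<n}. fib i) - (\<Pi>\<^sub>E i\<in>{..<n}. fib i - {0})"
        using p unfolding frontier_def fib_def by (auto simp: PiE_iff)
    next
      fix p assume p: "p \<in> (\<Pi>\<^sub>E i\<in>{..<n}. fib i) - (\<Pi>\<^sub>E i\<in>{..<n}. fib i - {0})"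
      then have "key p = t"
        using t unfolding key_def fib_def by (auto simp: PiE_iff extensional_def restrict_def fun_eq_iff)
      moreover have "p \<in> frontier"
        using p unfolding frontier_def fib_def by (auto simp: PiE_iff)
      ultimately show "p \<in> {p\<in>frontier. key p = t}" by blast
    qed
    moreover have "(\<Pi>\<^sub>E i\<in>{..<n}. fib i - {0}) \<subseteq> (\<Pi>\<^sub>E i\<in>{..<n}. fib i)"
      by (rule PiE_mono) auto
    ultimately have "card {p\<in>frontier. key p = t} =
        card (\<Pi>\<^sub>E i\<in>{..<n}. fib i) - card (\<Pi>\<^sub>E i\<in>{..<n}. fib i - {0})"
      using fin by (simp add: card_Diff_subset finite_PiE)
    also have "\<dots> = (\<Prod>i<n. card (fib i)) - (\<Prod>i<n. card (fib i - {0}))"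
      by (simp add: card_PiE)
    also have "(\<Prod>i<n. card (fib i)) = (\<Prod>i<n. a i (t i))"
      by (rule prod.cong) (use card tl in \<open>auto simp: fib_def\<close>)
    also have "\<dots> = (\<Prod>i\<in>{i. i < n \<and> t i = 0}. a i (t i)) * (\<Prod>i\<in>{i. i < n \<and> t i > 0}. a i (t i))"
      by (subst prod.union_disjoint[symmetric]) (auto intro!: prod.cong)
    also have "(\<Prod>i\<in>{i. i < n \<and> t i = 0}. a i (t i)) = (\<Prod>i\<in>{i. i < n \<and> t i = 0}. a i 0)"
      by (rule prod.cong) auto
    also have "(\<Prod>i<n. card (fib i - {0})) = (\<Prod>i<n. if t i = 0 then a i 0 - 1 else a i (t i))"
    proof (rule prod.cong[OF refl])
      fix i assume "i \<in> {..<n}"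
      then have i: "i < n" "t i < l i" using tl by auto
      have c: "card (fib i) = a i (t i)" using card[OF i(2)] unfolding fib_def .
      \<comment> \<open>Index 0 lies in the fibre of \<open>i\<close> only if
        \<open>t i = 0\<close>; there, avoiding it lowers the coefficient by 1.\<close>
      have "0 \<in> fib i \<longleftrightarrow> t i = 0" using \<kappa>0[OF i(1)] i(2) unfolding fib_def by auto
      then show "card (fib i - {0}) = (if t i = 0 then a i 0 - 1 else a i (t i))"
        using c fin[of i] by auto
    qed
    also have "\<dots> = (\<Prod>i\<in>{i. i < n \<and> t i = 0}. if t i = 0 then a i 0 - 1 else a i (t i)) *
        (\<Prod>i\<in>{i. i < n \<and> t i > 0}. if t i = 0 then a i 0 - 1 else a i (t i))"
      by (subst prod.union_disjoint[symmetric]) (auto intro!: prod.cong)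
    also have "\<dots> = (\<Prod>i\<in>{i. i < n \<and> t i = 0}. a i 0 - 1) * (\<Prod>i\<in>{i. i < n \<and> t i > 0}. a i (t i))"
      by (intro arg_cong2[where f = "(*)"] prod.cong) auto
    finally show ?thesis unfolding grid_coeff_def diff_mult_distrib .
  qed
  have "wd (fle n) (box n M) = (\<Sum>p\<in>frontier. cell_wd p)"
    using wd_box[OF ex_min_coordinate[OF n]] box_cong[of n M "\<lambda>i. \<Sum>j<L i. {#y i j#}"] My by simp
  also have "\<dots> = (\<Sum>t\<in>?T. \<Sum>p\<in>{p\<in>frontier. key p = t}. cell_wd p)"
    by (rule sum.group[symmetric, OF finite_frontier finT key])
  also have "\<dots> = (\<Sum>t\<in>?T. repeat_mset (grid_coeff n a t) (v t))"
  proof (rule sum.cong[OF refl])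
    fix t assume t: "t \<in> ?T"
    have "(\<Sum>p\<in>{p\<in>frontier. key p = t}. cell_wd p) = (\<Sum>p\<in>{p\<in>frontier. key p = t}. v t)"
      by (rule sum.cong) (auto simp: cell)
    also have "\<dots> = repeat_mset (grid_coeff n a t) (v t)"
      using finite_frontier by (subst sum_const_mset) (auto simp: fiber[OF t])
    finally show "(\<Sum>p\<in>{p\<in>frontier. key p = t}. cell_wd p) = repeat_mset (grid_coeff n a t) (v t)" .
  qed
  finally show ?thesis unfolding v_def .
qed


lemma mset_eq_decreasing_sum:
  fixes M :: "'o::linorder multiset"
  obtains z :: "nat \<Rightarrow> 'o" and s where "\<And>j k. j \<le> k \<Longrightarrow> k < s \<Longrightarrow> z k \<le> z j" "M = (\<Sum>j<s. {#z j#})"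
proof -
  define zs where "zs = rev (sorted_list_of_multiset M)"
  have "mset xs = (\<Sum>j<length xs. {#xs ! j#})" for xs :: "'o list"
  proof (induction xs rule: rev_induct)
    case (snoc x xs)
    have "(\<Sum>j<length xs. {#(xs @ [x]) ! j#}) = (\<Sum>j<length xs. {#xs ! j#})"
      by (rule sum.cong) (auto simp: nth_append)
    then show ?case using snoc by simp
  qed simp
  then have "M = (\<Sum>j<length zs. {#zs ! j#})" by (metis mset_rev mset_sorted_list_of_multiset zs_def)
  moreover have "zs ! k \<le> zs ! j" if "j \<le> k" "k < length zs" for j k
  proof -
    have "sorted (rev zs)" unfolding zs_def by (simp add: sorted_sorted_list_of_multiset)
    then show ?thesis using that sorted_rev_nth_mono by blast
  qed
  ultimately show ?thesis using that by blast
qed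

lemma rel_Inl_ordIso: "Well_order r \<Longrightarrow> r =o (rel_Inl r :: ('a + 'b) rel)"
proof -
  assume "Well_order r"
  then have "r =o dir_image r (Inl :: 'a \<Rightarrow> 'a + 'b)" by (rule dir_image_ordIso) simp
  moreover have "dir_image r Inl = (rel_Inl r :: ('a + 'b) rel)"
    unfolding dir_image_def rel_Inl_def by force
  ultimately show ?thesis by simp
qed

lemma rel_Inr_ordIso: "Well_order r \<Longrightarrow> r =o (rel_Inr r :: ('a + 'b) rel)"
proof -
  assume "Well_order r"
  then have "r =o dir_image r (Inr :: 'b \<Rightarrow> 'a + 'b)" by (rule dir_image_ordIso) simp
  moreover have "dir_image r Inr = (rel_Inr r :: ('a + 'b) rel)"
    unfolding dir_image_def rel_Inr_def by force
  ultimately show ?thesis by simp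
qed

section \<open>The formula for developed normal forms\<close>

lemma developed_cnf_formula:
  fixes \<alpha> :: "nat \<Rightarrow> 'a rel" and e :: "nat \<Rightarrow> nat \<Rightarrow> 'a rel"
  assumes n: "n \<ge> 1" and inf: "\<And>i. i < n \<Longrightarrow> infinite (Field (\<alpha> i))"
    and cnf: "\<And>i. i < n \<Longrightarrow> is_dev_cnf (\<alpha> i) (l i) (e i) (a i)"
  shows "is_hessenberg_comb (width_prod (map \<alpha> [0..<n]))
    {t :: nat list. length t = n \<and> (\<forall>i<n. t ! i < l i) \<and> (\<exists>k<n. t ! k = 0)}
    (\<lambda>t. width_prod (map (\<lambda>i. omega_exp (e i (t ! i))) [0..<n]))
    (\<lambda>t. grid_coeff n a (\<lambda>i. t ! i))" (is "is_hessenberg_comb _ ?T _ _")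
proof -
  have "\<forall>i j. \<exists>x :: 'a list suc. i < n \<longrightarrow> j < l i \<longrightarrow> e i j =o below x"
    using cnf ex_below_suc unfolding is_dev_cnf_def by metis
  then obtain x :: "nat \<Rightarrow> nat \<Rightarrow> 'a list suc"
    where x: "\<And>i j. i < n \<Longrightarrow> j < l i \<Longrightarrow> e i j =o below (x i j)"
    by metis
  have pos: "a i j > 0" if "i < n" "j < l i" for i j
    using cnf[OF that(1)] that(2) unfolding is_dev_cnf_def by blast
  have step: "x i (Suc j) < x i j" if "i < n" "Suc j < l i" for i j
  proof -
    have "e i (Suc j) <o e i j" using cnf[OF that(1)] that(2) unfolding is_dev_cnf_def by blast
    then have "below (x i (Suc j)) <o below (x i j)"
      using x[of i j] x[of i "Suc j"] that ordIso_symmetric ordIso_ordLess_trans ordLess_ordIso_trans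
      by (metis Suc_lessD)
    then show ?thesis by (rule below_ordLess_imp)
  qed
  have dec: "x i k \<le> x i j" if "i < n" "j \<le> k" "k < l i" for i j k
    using that(2,3)
  proof (induction k rule: dec_induct)
    case (step k)
    then show ?case using \<open>\<And>i j. i < n \<Longrightarrow> Suc j < l i \<Longrightarrow> x i (Suc j) < x i j\<close>[of i k] that(1) by simp
  qed simp
  define M where "M = (\<lambda>i. \<Sum>j<l i. replicate_mset (a i j) (x i j))"
  have iso: "\<alpha> i =o below (M i)" if "i < n" for i
  proof -
    have "\<alpha> i =o cnf_ord (l i) (e i) (a i)"
      using cnf[OF that] unfolding is_dev_cnf_def by blast
    moreover have "cnf_ord (l i) (e i) (a i) =o below (M i)"
      unfolding M_def by (rule cnf_ord_ordIso) (use x dec that in auto)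
    ultimately show ?thesis by (rule ordIso_transitive)
  qed
  obtain K :: "'a list suc multiset" where bd: "wle (fle n) (box n M) K"
    using wle_box_of_orders[of n \<alpha> M] iso by blast
  define w :: "nat list \<Rightarrow> 'a list suc multiset"
    where "w = (\<lambda>t. wd (fle n) (cube n (\<lambda>i. x i (t ! i))))"
  show ?thesis
  proof (rule is_hessenberg_combI[where w = w])
    have "?T \<subseteq> {t. set t \<subseteq> (\<Union>i<n. {..<l i}) \<and> length t = n}"
      by (auto simp: in_set_conv_nth) blast
    then show "finite ?T" by (rule finite_subset) (simp add: finite_lists_length_eq)
    show "width_prod (map \<alpha> [0..<n]) =o below (wd (fle n) (box n M) :: 'a list suc multiset)"
      by (rule width_prod_ordIso_wd[OF _ _ bd]) (use iso in auto)
    fix t assume t: "t \<in> ?T"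
    \<comment> \<open>The cube of \<open>t\<close> thus lies inside the whole box, whose bound
      \<open>K\<close> serves for it as well.\<close>
    have "M i \<ge> {#x i (t ! i)#}" if "i < n" for i
    proof -
      have "t ! i < l i" using t that by auto
      then have "0 < count (replicate_mset (a i (t ! i)) (x i (t ! i))) (x i (t ! i))"
        using pos that by simp
      also have "\<dots> \<le> count (M i) (x i (t ! i))"
        unfolding M_def count_sum using \<open>t ! i < l i\<close>
        by (intro member_le_sum[of "t ! i" _ "\<lambda>j. count (replicate_mset (a i j) (x i j)) (x i (t ! i))"]) auto
      finally show ?thesis by (intro subset_eq_imp_le_multiset) simp
    qed
    then have "wle (fle n) (cube n (\<lambda>i. x i (t ! i))) K"
      by (intro wle_mono[OF bd order_refl] box_mono)
    then show "width_prod (map (\<lambda>i. omega_exp (e i (t ! i))) [0..<n]) =o below (w t)"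
      unfolding w_def
      by (rule width_prod_ordIso_wd[rotated 2]) (use x t in \<open>auto intro!: omega_exp_ordIso\<close>)
    have "0 < (\<Prod>i\<in>{i. i < n \<and> t ! i = 0}. a i 0) - (\<Prod>i\<in>{i. i < n \<and> t ! i = 0}. a i 0 - 1)"
      by (rule prod_diff_pos) (use t pos in force)+
    then show "0 < grid_coeff n a (\<lambda>i. t ! i)"
      unfolding grid_coeff_def using t pos by (auto intro!: prod_pos)
  next
    have "wd (fle n) (box n M) =
      (\<Sum>t\<in>{t\<in>\<Pi>\<^sub>E i\<in>{..<n}. {..<l i}. \<exists>i<n. t i = 0}.
        repeat_mset (grid_coeff n a t) (wd (fle n) (cube n (\<lambda>i. x i (t i))) :: 'a list suc multiset))"
      by (rule wd_product[OF n _ _ _ _ _ bd, of l x a \<alpha>]) (use dec pos iso inf M_def in auto)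
    also have "\<dots> = (\<Sum>t\<in>?T. repeat_mset (grid_coeff n a (\<lambda>i. t ! i)) (w t))"
    \<comment> \<open>Passes between the lists of the statement and the extensional functions of
      \<open>wd_product\<close>.\<close>
    proof (rule sum.reindex_bij_witness[where i = "\<lambda>t. \<lambda>i\<in>{..<n}. t ! i" and j = "\<lambda>t. map t [0..<n]"])
      fix t assume t: "t \<in> {t\<in>\<Pi>\<^sub>E i\<in>{..<n}. {..<l i}. \<exists>i<n. t i = 0}"
      show "(\<lambda>i\<in>{..<n}. map t [0..<n] ! i) = t"
        using t by (auto simp: PiE_iff extensional_def restrict_def fun_eq_iff)
      show "map t [0..<n] \<in> ?T" using t by auto
      have "cube n (\<lambda>i. x i (map t [0..<n] ! i)) = cube n (\<lambda>i. x i (t i))"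
        by (rule box_cong) simp
      moreover have "grid_coeff n a (\<lambda>i. map t [0..<n] ! i) = grid_coeff n a t"
        by (rule grid_coeff_cong) simp
      ultimately show "repeat_mset (grid_coeff n a (\<lambda>i. map t [0..<n] ! i)) (w (map t [0..<n])) =
          repeat_mset (grid_coeff n a t) (wd (fle n) (cube n (\<lambda>i. x i (t i))))"
        unfolding w_def by simp
    next
      fix t assume t: "t \<in> ?T"
      show "map (\<lambda>i\<in>{..<n}. t ! i) [0..<n] = t"
        using t by (auto intro: nth_equalityI)
      show "(\<lambda>i\<in>{..<n}. t ! i) \<in> {t\<in>\<Pi>\<^sub>E i\<in>{..<n}. {..<l i}. \<exists>i<n. t i = 0}"
        using t by auto
    qed
    finally show "wd (fle n) (box n M) = (\<Sum>t\<in>?T. repeat_mset (grid_coeff n a (\<lambda>i. t ! i)) (w t))" .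
  qed
qed


section \<open>The formula for short normal forms\<close>

lemma short_form_formula:
  fixes \<alpha> \<sigma> e :: "nat \<Rightarrow> 'a rel"
  assumes n: "n \<ge> 1" and inf: "\<And>i. i < n \<Longrightarrow> infinite (Field (\<alpha> i))"
    and nf: "\<And>i. i < n \<Longrightarrow> Well_order (e i) \<and> Well_order (\<sigma> i) \<and> a i > 0 \<and> \<sigma> i <o omega_exp (e i) \<and>
        \<alpha> i =o ord_sum2 (ord_mult_nat (omega_exp (e i)) (a i)) (\<sigma> i)"
  shows "is_hessenberg_comb (width_prod (map \<alpha> [0..<n])) {I. I \<subseteq> {..<n} \<and> I \<noteq> {}}
    (\<lambda>I. width_prod (map (\<lambda>i. if i \<in> I then rel_Inr (omega_exp (e i)) else rel_Inl (\<sigma> i)) [0..<n]))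
    (\<lambda>I. (\<Prod>i\<in>I. a i) - (\<Prod>i\<in>I. a i - 1))" (is "is_hessenberg_comb _ ?T _ _")
proof -
  have "\<forall>i. \<exists>x :: 'a list suc. i < n \<longrightarrow> e i =o below x"
    using nf ex_below_suc by metis
  then obtain x :: "nat \<Rightarrow> 'a list suc" where x: "\<And>i. i < n \<Longrightarrow> e i =o below (x i)" by metis
  have "\<forall>i. \<exists>N :: 'a list suc multiset. i < n \<longrightarrow> \<sigma> i =o below N"
    using nf ex_below_suc_mset by metis
  then obtain N :: "nat \<Rightarrow> 'a list suc multiset" where N: "\<And>i. i < n \<Longrightarrow> \<sigma> i =o below (N i)" by metis
  define P where "P = (\<lambda>i (z :: nat \<Rightarrow> 'a list suc) s.
    (\<forall>j k. j \<le> k \<longrightarrow> k < s \<longrightarrow> z k \<le> z j) \<and> N i = (\<Sum>j<s. {#z j#}))"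
  have "\<forall>i. \<exists>z s. P i z s"
  proof
    fix i
    show "\<exists>z s. P i z s"
      unfolding P_def by (rule mset_eq_decreasing_sum[of "N i"]) blast
  qed
  from choice[OF this] obtain z where "\<forall>i. \<exists>s. P i (z i) s" by (rule exE)
  from choice[OF this] obtain s where P: "\<forall>i. P i (z i) (s i)" by (rule exE)
  have zdec: "\<And>i j k. j \<le> k \<Longrightarrow> k < s i \<Longrightarrow> z i k \<le> z i j"
    and Nz: "\<And>i. N i = (\<Sum>j<s i. {#z i j#})"
    using P unfolding P_def by blast+
  have \<omega>: "omega_exp (e i) =o below {#x i#}" if "i < n" for i
    by (rule omega_exp_ordIso[OF x[OF that]])
  have Nx: "N i < {#x i#}" if "i < n" for i
  proof (rule below_ordLess_imp)
    show "below (N i) <o below {#x i#}"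
      using ordIso_ordLess_trans[OF ordIso_symmetric[OF N[OF that]]] nf[OF that]
        ordLess_ordIso_trans[OF _ \<omega>[OF that]] by blast
  qed
  have zx: "z i j < x i" if "i < n" "j < s i" for i j
  proof -
    have "z i j \<in># N i" unfolding Nz using that(2) by (auto simp: set_mset_sum)
    then show ?thesis using Nx[OF that(1)] by simp
  qed
  define M where "M = (\<lambda>i. replicate_mset (a i) (x i) + N i)"
  have iso: "\<alpha> i =o below (M i)" if "i < n" for i
  proof -
    have "mset_ge (replicate_mset (a i) (x i)) (N i)"
      using Nx[OF that] by (auto simp: mset_ge_def less_imp_le)
    then have "ord_sum2 (ord_mult_nat (omega_exp (e i)) (a i)) (\<sigma> i) =o below (M i)"
      unfolding M_def by (rule ord_sum2_ordIso[OF ord_mult_nat_ordIso[OF \<omega>[OF that]] N[OF that]])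
    then show ?thesis using nf[OF that] ordIso_transitive by blast
  qed
  obtain K :: "'a list suc multiset" where bd: "wle (fle n) (box n M) K"
    using wle_box_of_orders[of n \<alpha> M] iso by blast
  \<comment> \<open>Term 0 is the leading power with coefficient \<open>a i\<close>. The exponents
    of \<open>\<sigma> i\<close> follow one by one with coefficient 1, repetitions included, since
    \<open>wd_product\<close> allows equal exponents.\<close>
  define x' where "x' = (\<lambda>i. case_nat (x i) (z i))"
  define a' where "a' = (\<lambda>i j :: nat. if j = 0 then a i else 1)"
  have Mx': "M i = (\<Sum>j<Suc (s i). replicate_mset (a' i j) (x' i j))" for i
    unfolding M_def Nz x'_def a'_def by (simp add: sum.lessThan_Suc_shift del: sum.lessThan_Suc)
  have x'dec: "x' i k \<le> x' i j" if "i < n" "j \<le> k" "k < Suc (s i)" for i j k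
    using that zdec[of "j - 1" "k - 1" i] zx[of i "k - 1"] less_imp_le
    unfolding x'_def by (auto split: nat.splits)
  have limit: "\<exists>b. b < x i" if "i < n" for i
  proof -
    \<comment> \<open>\<open>M i\<close> as a sequence of single blocks, beginning with the
      \<open>a i\<close> copies of \<open>x i\<close>; since \<open>a i > 0\<close>,
      \<open>infinite_imp_limit\<close> then speaks about \<open>x i\<close>.\<close>
    define y where "y = (\<lambda>k. if k < a i then x i else z i (k - a i))"
    have "(\<Sum>k<a i + q. {#y k#}) = (\<Sum>k<a i. {#y k#}) + (\<Sum>j<q. {#y (a i + j)#})" for q
      by (induction q) simp_all
    then have "(\<Sum>k<a i + s i. {#y k#}) = (\<Sum>k<a i. {#y k#}) + (\<Sum>j<s i. {#y (a i + j)#})" .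
    also have "(\<Sum>k<a i. {#y k#}) = (\<Sum>k<a i. {#x i#})" by (rule sum.cong) (auto simp: y_def)
    also have "\<dots> = replicate_mset (a i) (x i)" by (simp add: sum_const_mset)
    also have "(\<Sum>j<s i. {#y (a i + j)#}) = N i" unfolding Nz by (rule sum.cong) (auto simp: y_def)
    finally have "\<alpha> i =o below (\<Sum>k<a i + s i. {#y k#})" using iso[OF that] unfolding M_def by simp
    moreover have "y k \<le> y j" if "j \<le> k" "k < a i + s i" for j k
      using that zdec[of "j - a i" "k - a i" i] zx[OF \<open>i < n\<close>, of "k - a i"]
      unfolding y_def by (auto simp: less_imp_le)
    ultimately have "\<exists>b. b < y 0" by (rule infinite_imp_limit[OF _ inf[OF that]])
    then show ?thesis using nf[OF that] by (simp add: y_def)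
  qed
  define MI where "MI = (\<lambda>I i. if i \<in> I then {#x i#} else N i)"
  define w :: "nat set \<Rightarrow> 'a list suc multiset" where "w = (\<lambda>I. wd (fle n) (box n (MI I)))"
  define v :: "(nat \<Rightarrow> nat) \<Rightarrow> 'a list suc multiset"
    where "v = (\<lambda>t. wd (fle n) (cube n (\<lambda>i. x' i (t i))))"
  have bdI: "wle (fle n) (box n (MI I)) K" for I
  proof (rule wle_mono[OF bd order_refl box_mono])
    fix i assume "i < n"
    have "{#x i#} \<subseteq># M i" using nf[OF \<open>i < n\<close>] unfolding M_def by simp
    moreover have "N i \<subseteq># M i" unfolding M_def by simp
    ultimately show "MI I i \<le> M i" unfolding MI_def by (auto intro: subset_eq_imp_le_multiset)
  qed
  let ?P = "\<Pi>\<^sub>E i\<in>{..<n}. {..<Suc (s i)}"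
  let ?zero = "\<lambda>t :: nat \<Rightarrow> nat. {i. i < n \<and> t i = 0}"
  \<comment> \<open>With \<open>I\<close> in the role of \<open>J\<close>, coordinates in
    \<open>I\<close> have a single block, so every cell is a frontier cell. The cells are those
    positions of the expanded product whose zero set is \<open>I\<close>. If some
    \<open>\<sigma> i\<close> outside \<open>I\<close> is empty, both sides are 0.\<close>
  have wI: "w I = (\<Sum>t\<in>{t\<in>?P. ?zero t = I}. v t)" if I: "I \<in> ?T" for I
  proof -
    define L where "L = (\<lambda>i. if i \<in> I then 1 else s i)"
    define y where "y = (\<lambda>i j. if i \<in> I then x i else z i j)"
    have My: "MI I i = (\<Sum>j<L i. {#y i j#})" for i
      unfolding MI_def L_def y_def Nz by auto
    interpret staircase n y L I
    proof
      show "y i k \<le> y i j" if "i < n" "j \<le> k" "k < L i" for i j k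
        using that zdec unfolding y_def L_def by auto
      show "\<exists>b. b < y i 0" if "i \<in> I" for i
        using that I limit unfolding y_def by auto
      show "\<exists>K :: 'a list suc multiset. wle (fle n) (box n (\<lambda>i. \<Sum>j<L i. {#y i j#})) K"
        using bdI[of I] unfolding My[abs_def] by blast
    qed (use I in blast)
    have zero: "p i = 0" if "p \<in> positions" "i \<in> I" for p i
    proof -
      have "p i < L i" using that I by (auto simp: PiE_iff)
      then show ?thesis using that(2) unfolding L_def by simp
    qed
    obtain i0 where i0: "i0 \<in> I" using I by blast
    have "w I = (\<Sum>p\<in>frontier. cell_wd p)"
      unfolding w_def My[abs_def]
    proof (rule wd_box)
      fix p assume "p \<in> positions"
      then have "p i0 = 0" using zero i0 by blast
      then show "\<exists>i\<in>I. \<forall>j<n. p i \<le> p j" by (intro bexI[OF _ i0]) simp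
    qed
    also have "frontier = positions" unfolding frontier_def using zero i0 by blast
    also have "(\<Sum>p\<in>positions. cell_wd p) = (\<Sum>t\<in>{t\<in>?P. ?zero t = I}. v t)"
    \<comment> \<open>Outside \<open>I\<close> the index moves by one, since term 0 of
      \<open>x'\<close> is the leading power; on \<open>I\<close> truncated subtraction gives
      0.\<close>
    proof (rule sum.reindex_bij_witness[where i = "\<lambda>t. \<lambda>i\<in>{..<n}. t i - 1"
          and j = "\<lambda>p. \<lambda>i\<in>{..<n}. if i \<in> I then 0 else Suc (p i)"])
      fix p assume p: "p \<in> positions"
      show "(\<lambda>i\<in>{..<n}. (\<lambda>i\<in>{..<n}. if i \<in> I then 0 else Suc (p i)) i - 1) = p"
        using p zero[OF p] by (auto simp: PiE_iff extensional_def restrict_def fun_eq_iff)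
      have "p i < s i" if "i < n" "i \<notin> I" for i
        using PiE_mem[OF p, of i] that unfolding L_def by simp
      then have "(\<lambda>i\<in>{..<n}. if i \<in> I then 0 else Suc (p i)) \<in> ?P" by auto
      moreover have "?zero (\<lambda>i\<in>{..<n}. if i \<in> I then 0 else Suc (p i)) = I"
        using I by auto
      ultimately show "(\<lambda>i\<in>{..<n}. if i \<in> I then 0 else Suc (p i)) \<in> {t\<in>?P. ?zero t = I}" by simp
      show "v (\<lambda>i\<in>{..<n}. if i \<in> I then 0 else Suc (p i)) = cell_wd p"
        unfolding v_def cell_wd_def
        by (rule arg_cong[where f = "wd (fle n)"], rule box_cong) (simp add: x'_def y_def)
    next
      fix t assume t: "t \<in> {t\<in>?P. ?zero t = I}"
      then have tI: "t i = 0 \<longleftrightarrow> i \<in> I" if "i < n" for i using that by auto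
      show "(\<lambda>i\<in>{..<n}. if i \<in> I then 0 else Suc ((\<lambda>i\<in>{..<n}. t i - 1) i)) = t"
        using t tI by (auto simp: PiE_iff extensional_def restrict_def fun_eq_iff)
      have "t i - 1 < L i" if "i < n" for i
      proof -
        have "t i < Suc (s i)" using t that by (auto simp: PiE_iff)
        then show ?thesis using tI[OF that] unfolding L_def by auto
      qed
      then show "(\<lambda>i\<in>{..<n}. t i - 1) \<in> positions" by auto
    qed
    finally show ?thesis .
  qed
  show ?thesis
  proof (rule is_hessenberg_combI[where w = w])
    show fin: "finite ?T" by simp
    show "width_prod (map \<alpha> [0..<n]) =o below (wd (fle n) (box n M) :: 'a list suc multiset)"
      by (rule width_prod_ordIso_wd[OF _ _ bd]) (use iso in auto)
    fix I assume I: "I \<in> ?T"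
    show "width_prod (map (\<lambda>i. if i \<in> I then rel_Inr (omega_exp (e i)) else rel_Inl (\<sigma> i)) [0..<n]) =o below (w I)"
      unfolding w_def
    proof (rule width_prod_ordIso_wd[OF _ _ bdI])
      fix i assume i: "i < n"
      have "(rel_Inr (omega_exp (e i)) :: ('a + ('a \<Rightarrow> nat)) rel) =o below {#x i#}"
        using rel_Inr_ordIso[of "omega_exp (e i)"] \<omega>[OF i] ordIso_symmetric ordIso_transitive
        unfolding ordIso_def by blast
      moreover have "(rel_Inl (\<sigma> i) :: ('a + ('a \<Rightarrow> nat)) rel) =o below (N i)"
        using ordIso_transitive[OF ordIso_symmetric[OF rel_Inl_ordIso] N[OF i]] nf[OF i] by blast
      ultimately show "map (\<lambda>i. if i \<in> I then rel_Inr (omega_exp (e i)) else rel_Inl (\<sigma> i)) [0..<n] ! i =o below (MI I i)"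
        using i unfolding MI_def by simp
    qed simp
    show "0 < (\<Prod>i\<in>I. a i) - (\<Prod>i\<in>I. a i - 1)"
    proof (rule prod_diff_pos)
      show "finite I" using I finite_subset[of I "{..<n}"] by auto
      show "a i > 0" if "i \<in> I" for i using nf[of i] I that by blast
    qed (use I in blast)
  next
    \<comment> \<open>All coefficients except the leading ones are 1, so \<open>grid_coeff\<close>
      depends only on the zero set of \<open>t\<close>.\<close>
    have coeff: "grid_coeff n a' t = (\<Prod>i\<in>?zero t. a i) - (\<Prod>i\<in>?zero t. a i - 1)" for t
      unfolding grid_coeff_def a'_def by simp
    have "wd (fle n) (box n M) =
      (\<Sum>t\<in>{t\<in>?P. \<exists>i<n. t i = 0}. repeat_mset (grid_coeff n a' t) (v t))"
      unfolding v_def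
      by (rule wd_product[OF n _ _ _ _ _ bd, of "\<lambda>i. Suc (s i)" x' a' \<alpha>])
        (use x'dec iso inf Mx' nf in \<open>auto simp: a'_def\<close>)
    \<comment> \<open>Grouping the positions by their zero set turns the sum into one over
      \<open>I\<close>.\<close>
    also have "\<dots> = (\<Sum>I\<in>?T. \<Sum>t\<in>{t\<in>{t\<in>?P. \<exists>i<n. t i = 0}. ?zero t = I}. repeat_mset (grid_coeff n a' t) (v t))"
      by (rule sum.group[symmetric]) (auto simp: finite_PiE)
    also have "\<dots> = (\<Sum>I\<in>?T. repeat_mset ((\<Prod>i\<in>I. a i) - (\<Prod>i\<in>I. a i - 1)) (w I))"
    proof (rule sum.cong[OF refl])
      fix I assume I: "I \<in> ?T"
      have "{t\<in>{t\<in>?P. \<exists>i<n. t i = 0}. ?zero t = I} = {t\<in>?P. ?zero t = I}" using I by auto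
      then have "(\<Sum>t\<in>{t\<in>{t\<in>?P. \<exists>i<n. t i = 0}. ?zero t = I}. repeat_mset (grid_coeff n a' t) (v t)) =
          (\<Sum>t\<in>{t\<in>?P. ?zero t = I}. repeat_mset ((\<Prod>i\<in>I. a i) - (\<Prod>i\<in>I. a i - 1)) (v t))"
        by (intro sum.cong) (auto simp: coeff)
      then show "(\<Sum>t\<in>{t\<in>{t\<in>?P. \<exists>i<n. t i = 0}. ?zero t = I}. repeat_mset (grid_coeff n a' t) (v t)) =
          repeat_mset ((\<Prod>i\<in>I. a i) - (\<Prod>i\<in>I. a i - 1)) (w I)"
        unfolding wI[OF I] repeat_mset_sum .
    qed
    finally show "wd (fle n) (box n M) =
      (\<Sum>I\<in>?T. repeat_mset ((\<Prod>i\<in>I. a i) - (\<Prod>i\<in>I. a i - 1)) (w I))" .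
  qed
qed


theorem mainTheorem12:
  fixes n :: nat and \<alpha> :: "nat \<Rightarrow> 'a rel"
  assumes "n \<ge> 1"
    and "\<forall>i<n. Well_order (\<alpha> i) \<and> infinite (Field (\<alpha> i))"
  shows
    "(\<forall>(l :: nat \<Rightarrow> nat) (e :: nat \<Rightarrow> nat \<Rightarrow> 'a rel) (a :: nat \<Rightarrow> nat \<Rightarrow> nat).
        (\<forall>i<n. is_dev_cnf (\<alpha> i) (l i) (e i) (a i)) \<longrightarrow>
        is_hessenberg_comb (width_prod (map \<alpha> [0..<n]))
          {t :: nat list. length t = n \<and> (\<forall>i<n. t ! i < l i) \<and> (\<exists>k<n. t ! k = 0)}
          (\<lambda>t. width_prod (map (\<lambda>i. omega_exp (e i (t ! i))) [0..<n]))
          (\<lambda>t. ((\<Prod>i\<in>{i. i < n \<and> t ! i = 0}. a i 0)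
                 - (\<Prod>i\<in>{i. i < n \<and> t ! i = 0}. a i 0 - 1))
               * (\<Prod>i\<in>{i. i < n \<and> t ! i > 0}. a i (t ! i))))
     \<and>
     (\<forall>(e :: nat \<Rightarrow> 'a rel) (a :: nat \<Rightarrow> nat) (\<sigma> :: nat \<Rightarrow> 'a rel).
        (\<forall>i<n. Well_order (e i) \<and> Well_order (\<sigma> i) \<and> a i > 0 \<and>
               (\<sigma> i, omega_exp (e i)) \<in> ordLess \<and>
               (\<alpha> i, ord_sum2 (ord_mult_nat (omega_exp (e i)) (a i)) (\<sigma> i)) \<in> ordIso) \<longrightarrow>
        is_hessenberg_comb (width_prod (map \<alpha> [0..<n]))
          {I. I \<subseteq> {..<n} \<and> I \<noteq> {}}
          (\<lambda>I. width_prod (map (\<lambda>i. if i \<in> I then rel_Inr (omega_exp (e i))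
                                              else rel_Inl (\<sigma> i)) [0..<n]))
          (\<lambda>I. (\<Prod>i\<in>I. a i) - (\<Prod>i\<in>I. a i - 1)))"
proof (intro conjI allI impI)
  fix l :: "nat \<Rightarrow> nat" and e :: "nat \<Rightarrow> nat \<Rightarrow> 'a rel" and a :: "nat \<Rightarrow> nat \<Rightarrow> nat"
  assume "\<forall>i<n. is_dev_cnf (\<alpha> i) (l i) (e i) (a i)"
  with assms show "is_hessenberg_comb (width_prod (map \<alpha> [0..<n]))
      {t. length t = n \<and> (\<forall>i<n. t ! i < l i) \<and> (\<exists>k<n. t ! k = 0)}
      (\<lambda>t. width_prod (map (\<lambda>i. omega_exp (e i (t ! i))) [0..<n]))
      (\<lambda>t. ((\<Prod>i\<in>{i. i < n \<and> t ! i = 0}. a i 0) - (\<Prod>i\<in>{i. i < n \<and> t ! i = 0}. a i 0 - 1))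
           * (\<Prod>i\<in>{i. i < n \<and> t ! i > 0}. a i (t ! i)))"
    using developed_cnf_formula[of n \<alpha> l e a] unfolding grid_coeff_def by blast
next
  fix e :: "nat \<Rightarrow> 'a rel" and a :: "nat \<Rightarrow> nat" and \<sigma> :: "nat \<Rightarrow> 'a rel"
  assume "\<forall>i<n. Well_order (e i) \<and> Well_order (\<sigma> i) \<and> a i > 0 \<and>
      (\<sigma> i, omega_exp (e i)) \<in> ordLess \<and>
      (\<alpha> i, ord_sum2 (ord_mult_nat (omega_exp (e i)) (a i)) (\<sigma> i)) \<in> ordIso"
  with assms show "is_hessenberg_comb (width_prod (map \<alpha> [0..<n])) {I. I \<subseteq> {..<n} \<and> I \<noteq> {}}
      (\<lambda>I. width_prod (map (\<lambda>i. if i \<in> I then rel_Inr (omega_exp (e i)) else rel_Inl (\<sigma> i)) [0..<n]))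
      (\<lambda>I. (\<Prod>i\<in>I. a i) - (\<Prod>i\<in>I. a i - 1))"
    by (intro short_form_formula) blast+
qed

end
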